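(* Let $d\ge 1$ and let $S\subset\mathbb{R}^d$ be a finite generic set of points. For a triangulation $t$ of $S$ with $d$-simplices $\Delta_i$, let $$C2(t)=\sum_i \|c(\Delta_i)\|^2\,\mathrm{vol}(\Delta_i),$$ where $c(\Delta_i)$ is the barycenter of $\Delta_i$. Then a triangulation $t$ of $S$ maximizes $C2$ over all triangulations of $S$ if and only if $t$ is the Delaunay triangulation of $S$.
   Context: A finite set $S\subset\mathbb{R}^d$ is called generic if it affinely spans $\mathbb{R}^d$ and no $d+2$ of its points lie on a common sphere. A triangulation of $S$ is a finite collection of nondegenerate $d$-simplices whose union is the convex hull of $S$, any two of which intersect in a common (possibly empty) face, and whose set of vertices is exactly $S$. The Delaunay triangulation of a generic $S$ is the straight-line dual of the Voronoi diagram of $S$: its $d$-simplices are the convex hulls of those $(d+1)$-element subsets of $S$ whose Voronoi cells have a common point, where the Voronoi cell of $p\in S$ is $\{x\in\mathbb{R}^d : \|x-p\|\le\|x-q\| \text{ for all } q\in S\}$; equivalently, its simplices are the nondegenerate $d$-simplices with vertices in $S$ whose circumscribed open ball contains no point of $S$. The barycenter of a $d$-simplex with vertices $x_{0},\dots,x_{d}$ is $\frac{1}{d+1}\sum_{j=0}^d x_j$. $\|\cdot\|$ is the Euclidean norm and $\mathrm{vol}$ is $d$-dimensional volume. *)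

theory Defs
  imports "HOL-Analysis.Analysis"
begin

text \<open>The ambient space $\mathbb{R}^d$ is an arbitrary type of class \<^class>\<open>euclidean_space\<close>,
  with $d$ = \<open>DIM('a)\<close>; this class forces $d \ge 1$.\<close>

definition generic_points :: "'a::euclidean_space set \<Rightarrow> bool" where
  "generic_points S \<longleftrightarrow>
     finite S \<and> affine hull S = UNIV \<and>
     \<not> (\<exists>T c r. T \<subseteq> S \<and> card T = DIM('a) + 2 \<and> T \<subseteq> sphere c r)"

definition vertices_of :: "'a::euclidean_space set \<Rightarrow> 'a set" where
  "vertices_of \<Delta> = {x. x extreme_point_of \<Delta>}"

text \<open>A triangulation is represented by the set of its top-dimensional simplices (each simplex
  being a subset of the space). The library predicate \<^const>\<open>triangulation\<close> allows
  simplices of mixed dimension, hence the extra dimension condition; it also requires finiteness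
  and that any two members meet in a common, possibly empty, face.\<close>

definition triangulation_of :: "'a::euclidean_space set \<Rightarrow> 'a set set \<Rightarrow> bool" where
  "triangulation_of S t \<longleftrightarrow>
     triangulation t \<and>
     (\<forall>\<Delta>\<in>t. int DIM('a) simplex \<Delta>) \<and>
     \<Union>t = convex hull S \<and>
     (\<Union>\<Delta>\<in>t. vertices_of \<Delta>) = S"

definition voronoi_cell :: "'a::euclidean_space set \<Rightarrow> 'a \<Rightarrow> 'a set" where
  "voronoi_cell S p = {x. \<forall>q\<in>S. norm (x - p) \<le> norm (x - q)}"

definition delaunay :: "'a::euclidean_space set \<Rightarrow> 'a set set" where
  "delaunay S = {convex hull T | T.
     T \<subseteq> S \<and> card T = DIM('a) + 1 \<and> (\<Inter>p\<in>T. voronoi_cell S p) \<noteq> {}}"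

definition barycenter :: "'a::euclidean_space set \<Rightarrow> 'a" where
  "barycenter \<Delta> = (1 / real (DIM('a) + 1)) *\<^sub>R (\<Sum>x\<in>vertices_of \<Delta>. x)"

definition C2 :: "'a::euclidean_space set set \<Rightarrow> real" where
  "C2 t = (\<Sum>\<Delta>\<in>t. (norm (barycenter \<Delta>))\<^sup>2 * measure lebesgue \<Delta>)"

end

theory Submission
  imports Defs
begin

text \<open>By affine invariance the integrals over a simplex of products of two barycentric coordinates
  are, up to the volume, constants \<open>a > b > 0\<close> that depend only on the dimension. Hence
  \<open>(norm (barycenter D))\<^sup>2 * vol D\<close> is a fixed combination of the integrals over \<open>D\<close> of
  \<open>(norm x)\<^sup>2\<close> and of the affine interpolant of \<open>(norm x)\<^sup>2\<close> at the vertices, the latter with a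
  negative coefficient. Summed over a triangulation the first integral depends only on the convex hull, so
  maximising \<^const>\<open>C2\<close> means minimising the integral of the piecewise affine interpolant of
  the paraboloid. The Delaunay interpolant is the lower boundary of the convex hull of the lifted
  points, hence the pointwise smallest one, and by genericity every other triangulation has a
  strictly larger interpolant on a set of positive measure.\<close>

section \<open>Linear changes of variables\<close>

text \<open>Why the sign comes out right: for a simplex with vertex set \<open>V\<close> and volume
  \<open>m\<close>, the two moment constants turn the integral of the squared norm into
  \<open>m * (b * (norm (\<Sum>V))\<^sup>2 + (a - b) * Q)\<close>, where \<open>Q\<close> is the sum
  of the squared vertex norms, and the integral of the interpolant into a positive multiple of
  \<open>m * Q\<close>. Eliminating \<open>Q\<close> isolates the squared norm of the barycenter,
  and \<open>a - b > 0\<close> puts a minus sign before the interpolant. Only these inequalities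
  matter, so neither the moments nor a determinant is ever evaluated: the Jacobian factor cancels in
  the quotient of moment and volume. Two triangulations need not share any simplex, so they are
  compared on the pieces \<open>D \<inter> D'\<close>, on which both interpolants are affine.
  Genericity acts in two ways: at most d + 1 points of \<open>S\<close> lie on a sphere, and any d +
  1 cospherical ones are affinely independent.\<close>

lemma nn_integral_lborel_translate:
  fixes c :: "'a::euclidean_space"
  assumes [measurable]: "f \<in> borel_measurable borel"
  shows "(\<integral>\<^sup>+ x. f (c + x) \<partial>lborel) = (\<integral>\<^sup>+ x. f x \<partial>lborel)"
proof -
  have "(\<integral>\<^sup>+ x. f x \<partial>lborel) = (\<integral>\<^sup>+ x. f x \<partial>distr lborel borel ((+) c))"
    by (simp add: lborel_distr_plus)
  also have "\<dots> = (\<integral>\<^sup>+ x. f (c + x) \<partial>lborel)"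
    by (subst nn_integral_distr) auto
  finally show ?thesis by simp
qed

text \<open>Uniqueness of Haar measure by Fubini: if \<open>\<nu>\<close> is the image of Lebesgue measure \<open>\<lambda>\<close> under
  \<open>T\<close>, then \<open>\<lambda> A * \<nu> B = \<lambda> B * \<nu> (- A)\<close>; the ball \<open>A\<close> is symmetric.\<close>

lemma lborel_distr_linear:
  fixes T :: "'a::euclidean_space \<Rightarrow> 'a"
  assumes "linear T" "bij T"
  obtains k :: real where "k > 0" "distr lborel borel T = density lborel (\<lambda>_. ennreal k)"
proof -
  have [measurable]: "T \<in> borel_measurable borel"
    using assms(1) by (simp add: borel_measurable_continuous_onI linear_continuous_on linear_conv_bounded_linear)
  define U where "U = inv T"
  have TU: "T (U x) = x" for x
    using assms(2) by (simp add: U_def bij_is_surj surj_f_inv_f)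
  define A where "A = ball (0::'a) 1"
  have [measurable]: "A \<in> sets borel" by (simp add: A_def)
  have key: "emeasure lborel A * emeasure lborel (T -` B) = emeasure lborel B * emeasure lborel (T -` A)"
    if [measurable]: "B \<in> sets borel" for B
  proof -
    have "emeasure lborel A * emeasure lborel (T -` B)
        = (\<integral>\<^sup>+ x. indicator A x * (\<integral>\<^sup>+ y. indicator B (T y) \<partial>lborel) \<partial>lborel)"
    proof -
      have "(\<integral>\<^sup>+ y. indicator B (T y) \<partial>lborel) = emeasure lborel (T -` B)"
        using measurable_sets[of T borel borel B]
        by (simp add: indicator_vimage[symmetric] flip: nn_integral_indicator)
      then show ?thesis
        by (simp only:) (subst nn_integral_multc, auto)
    qed
    also have "\<dots> = (\<integral>\<^sup>+ x. indicator A x * (\<integral>\<^sup>+ y. indicator B (x + T y) \<partial>lborel) \<partial>lborel)"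
    proof -
      \<comment> \<open>Writing \<open>x = T (U x)\<close> moves the shift inside \<open>T\<close>,
        where translation invariance removes it.\<close>
      have "(\<integral>\<^sup>+ y. indicator B (x + T y) \<partial>lborel) = (\<integral>\<^sup>+ y. indicator B (T y) \<partial>lborel)" for x
        using nn_integral_lborel_translate[of "\<lambda>y. indicator B (T y)" "U x"]
        by (simp add: linear_add[OF assms(1)] TU)
      then show ?thesis by simp
    qed
    also have "\<dots> = (\<integral>\<^sup>+ x. \<integral>\<^sup>+ y. indicator A x * indicator B (x + T y) \<partial>lborel \<partial>lborel)"
      by (intro nn_integral_cong nn_integral_cmult[symmetric]) measurable
    also have "\<dots> = (\<integral>\<^sup>+ y. \<integral>\<^sup>+ x. indicator A x * indicator B (x + T y) \<partial>lborel \<partial>lborel)"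
      by (rule lborel_pair.Fubini') measurable
    also have "\<dots> = (\<integral>\<^sup>+ y. \<integral>\<^sup>+ x. indicator A (x - T y) * indicator B x \<partial>lborel \<partial>lborel)"
    proof -
      have "(\<integral>\<^sup>+ x. indicator A (x - T y) * indicator B x \<partial>lborel) =
         (\<integral>\<^sup>+ x. indicator A x * indicator B (x + T y) \<partial>lborel)" for y
        using nn_integral_lborel_translate[of "\<lambda>x. indicator A (x - T y) * indicator B x" "T y"]
        by (simp add: add.commute)
      then show ?thesis by simp
    qed
    also have "\<dots> = (\<integral>\<^sup>+ x. \<integral>\<^sup>+ y. indicator A (x - T y) * indicator B x \<partial>lborel \<partial>lborel)"
      by (rule lborel_pair.Fubini') measurable
    also have "\<dots> = (\<integral>\<^sup>+ x. indicator B x * (\<integral>\<^sup>+ y. indicator A (x - T y) \<partial>lborel) \<partial>lborel)"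
      by (intro nn_integral_cong, subst mult.commute, rule nn_integral_cmult) measurable
    also have "\<dots> = (\<integral>\<^sup>+ x. indicator B x * emeasure lborel (T -` A) \<partial>lborel)"
    proof -
      have "(\<integral>\<^sup>+ y. indicator A (x - T y) \<partial>lborel) = emeasure lborel (T -` A)" for x
      proof -
        have "(\<integral>\<^sup>+ y. indicator A (x - T y) \<partial>lborel) = (\<integral>\<^sup>+ y. indicator A (T y - x) \<partial>lborel)"
          by (intro nn_integral_cong) (auto simp: A_def indicator_def norm_minus_commute)
        also have "\<dots> = (\<integral>\<^sup>+ y. indicator A (T y) \<partial>lborel)"
          using nn_integral_lborel_translate[of "\<lambda>y. indicator A (T y - x)" "U x"]
          by (simp add: linear_add[OF assms(1)] TU)
        also have "\<dots> = emeasure lborel (T -` A)"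
          using measurable_sets[of T borel borel A]
          by (simp add: indicator_vimage[symmetric] flip: nn_integral_indicator)
        finally show ?thesis .
      qed
      then show ?thesis by simp
    qed
    also have "\<dots> = emeasure lborel B * emeasure lborel (T -` A)"
      by (subst nn_integral_multc) auto
    finally show ?thesis .
  qed
  \<comment> \<open>The identity \<open>key\<close> determines the image measure up to a factor once
    both ball measures are positive and finite. The preimage of the ball is open and contains 0,
    hence not null; it is bounded, hence of finite measure.\<close>
  have open_pre: "open (T -` A)"
    using assms(1) unfolding A_def by (intro open_vimage) (auto simp: linear_continuous_on linear_conv_bounded_linear)
  have "bounded (U ` A)"
    using assms inj_linear_imp_inv_linear[of T] unfolding U_def A_def linear_conv_bounded_linear
    by (intro bounded_linear_image) (auto simp: bij_is_inj)
  moreover have "T -` A = U ` A"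
    using assms(2) unfolding U_def by (rule bij_vimage_eq_inv_image)
  ultimately have bdd: "bounded (T -` A)" by simp
  have nonnull: "emeasure lborel X \<noteq> 0" if "open X" "0 \<in> X" for X :: "'a set"
  proof
    assume "emeasure lborel X = 0"
    then have "X \<in> null_sets lebesgue"
      using that by (intro null_sets_completionI) (auto simp: null_sets_def)
    then show False
      using open_not_negligible[of X] that by (auto simp: negligible_iff_null_sets)
  qed
  have pos: "emeasure lborel (T -` A) \<noteq> 0"
    using nonnull[OF open_pre] assms(1) by (simp add: linear_0 A_def)
  have A: "emeasure lborel A \<noteq> 0" "emeasure lborel A < \<infinity>"
    using emeasure_bounded_finite[of A] nonnull[of A] by (auto simp: A_def)
  define k where "k = measure lborel (T -` A) / measure lborel A"
  have fT: "emeasure lborel (T -` A) = ennreal (measure lborel (T -` A))"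
    using emeasure_bounded_finite[OF bdd] by (intro emeasure_eq_ennreal_measure) auto
  have fA: "emeasure lborel A = ennreal (measure lborel A)"
    using A by (intro emeasure_eq_ennreal_measure) auto
  have mpos: "measure lborel A > 0" "measure lborel (T -` A) > 0"
  proof -
    have "measure lborel X > 0" if "emeasure lborel X \<noteq> 0" "emeasure lborel X = ennreal (measure lborel X)" for X :: "'a set"
      using that(1) measure_nonneg[of lborel X] by (subst (asm) that(2)) (simp add: less_eq_real_def)
    then show "measure lborel A > 0" "measure lborel (T -` A) > 0"
      using A(1) pos fA fT by blast+
  qed
  show thesis
  proof (rule that)
    show "k > 0" using mpos by (simp add: k_def)
    show "distr lborel borel T = density lborel (\<lambda>_. ennreal k)"
    proof (rule measure_eqI)
      fix B assume "B \<in> sets (distr lborel borel T)"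
      then have [measurable]: "B \<in> sets borel" by simp
      have "emeasure lborel (T -` B) = ennreal k * emeasure lborel B"
      proof -
        have *: "ennreal (measure lborel A) * (ennreal k * emeasure lborel B)
              = ennreal (measure lborel A) * emeasure lborel (T -` B)"
        proof -
          have "ennreal (measure lborel A) * ennreal k = ennreal (measure lborel (T -` A))"
            using mpos by (subst ennreal_mult[symmetric]) (auto simp: k_def)
          then have "ennreal (measure lborel A) * (ennreal k * emeasure lborel B) = emeasure lborel B * emeasure lborel (T -` A)"
            by (simp only: fT mult.assoc[symmetric] mult.commute)
          also have "\<dots> = ennreal (measure lborel A) * emeasure lborel (T -` B)"
            using key[OF \<open>B \<in> sets borel\<close>] by (simp only: fA)
          finally show ?thesis .
        qed
        then show ?thesis
          using mpos by (subst (asm) ennreal_mult_cancel_left) auto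
      qed
      then show "emeasure (distr lborel borel T) B = emeasure (density lborel (\<lambda>_. ennreal k)) B"
        by (simp add: emeasure_distr emeasure_density_const)
    qed simp
  qed
qed

section \<open>Barycentric coordinates\<close>

definition affine_basis :: "'a::euclidean_space set \<Rightarrow> bool" where
  "affine_basis V \<longleftrightarrow> \<not> affine_dependent V \<and> card V = DIM('a) + 1"

text \<open>The choice picks the affine function dual to the vertex \<open>v\<close>. A function of
  the form \<open>a \<bullet> x + b\<close> on the whole space, rather than a coefficient of a
  combination, is visibly continuous and has a hyperplane as its zero set; outside the simplex some
  coordinate is negative.\<close>

definition bary :: "'a::euclidean_space set \<Rightarrow> 'a \<Rightarrow> 'a \<Rightarrow> real" where
  "bary V v = (SOME f. (\<exists>a b. \<forall>x. f x = a \<bullet> x + b) \<and> (\<forall>w\<in>V. f w = (if w = v then 1 else 0)))"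

text \<open>Moving one point \<open>v0\<close> to the origin turns affine into linear independence,
  and values on independent vectors extend linearly. The codomain is general: the reals give
  barycentric coordinates, the space itself gives the map between two simplices.\<close>

lemma affine_interpolation:
  fixes F :: "'a::euclidean_space \<Rightarrow> 'b::real_vector"
  assumes "\<not> affine_dependent V"
  obtains g c where "linear g" "\<And>v. v \<in> V \<Longrightarrow> F v = c + g v"
proof (cases "V = {}")
  case True
  then show ?thesis using that[of "\<lambda>_. 0" 0] by (simp add: linear_iff)
next
  case False
  then obtain v0 where v0: "v0 \<in> V" by auto
  then have "independent ((\<lambda>x. - v0 + x) ` (V - {v0}))"
    using assms affine_dependent_iff_dependent2 by blast
  from linear_independent_extend[OF this, of "\<lambda>y. F (v0 + y) - F v0"]
  obtain g where g: "linear g"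
    "\<And>y. y \<in> (\<lambda>x. - v0 + x) ` (V - {v0}) \<Longrightarrow> g y = F (v0 + y) - F v0" by blast
  have "F v = (F v0 - g v0) + g v" if "v \<in> V" for v
  proof (cases "v = v0")
    case False
    then have "g (- v0 + v) = F v - F v0"
      using g(2)[of "- v0 + v"] that by auto
    then show ?thesis
      by (simp add: linear_diff[OF g(1)] algebra_simps)
  qed simp
  with g(1) show ?thesis by (rule that)
qed

lemma affine_basis_finite: "affine_basis V \<Longrightarrow> finite V"
  by (simp add: affine_basis_def aff_independent_finite)

lemma affine_basis_affine_hull: "affine_basis V \<Longrightarrow> affine hull V = UNIV"
  by (simp add: affine_basis_def affine_independent_span_eq)

lemma bary_SOME:
  fixes V :: "'a::euclidean_space set"
  assumes "affine_basis V"
  shows "(\<exists>a b. \<forall>x. bary V v x = a \<bullet> x + b) \<and> (\<forall>w\<in>V. bary V v w = (if w = v then 1 else 0))"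
proof -
  obtain g :: "'a \<Rightarrow> real" and c where g: "linear g" "\<And>w. w \<in> V \<Longrightarrow> (if w = v then 1 else 0) = c + g w"
    using assms affine_interpolation[of V "\<lambda>w. if w = v then 1 else (0::real)"]
    unfolding affine_basis_def by blast
  \<comment> \<open>The vector representing the functional \<open>g\<close> by an inner product is
    its adjoint at \<open>1\<close>.\<close>
  have "c + g x = adjoint g 1 \<bullet> x + c" for x
    using adjoint_works[OF g(1), of x 1] by (simp add: inner_commute)
  with g(2) have "(\<exists>a b. \<forall>x. (\<lambda>x. c + g x) x = a \<bullet> x + b) \<and> (\<forall>w\<in>V. (\<lambda>x. c + g x) w = (if w = v then 1 else 0))"
    by metis
  then show ?thesis
    unfolding bary_def
    by (rule someI[where P = "\<lambda>f. (\<exists>a b. \<forall>x. f x = a \<bullet> x + b) \<and> (\<forall>w\<in>V. f w = (if w = v then 1 else 0))"])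
qed

lemma bary_affine:
  assumes "affine_basis V"
  obtains a b where "\<And>x. bary V v x = a \<bullet> x + b"
  using bary_SOME[OF assms, of v] by blast

lemma bary_vertex: "affine_basis V \<Longrightarrow> w \<in> V \<Longrightarrow> bary V v w = (if w = v then 1 else 0)"
  using bary_SOME[of V v] by blast

lemma continuous_on_bary:
  assumes "affine_basis V"
  shows "continuous_on A (bary V v)"
proof -
  obtain a b where "\<And>x. bary V v x = a \<bullet> x + b"
    using bary_affine[OF assms] by blast
  then have "bary V v = (\<lambda>x. a \<bullet> x + b)" by blast
  then show ?thesis by (auto intro!: continuous_intros)
qed

lemma borel_measurable_bary: "affine_basis V \<Longrightarrow> bary V v \<in> borel_measurable borel"
  by (intro borel_measurable_continuous_onI continuous_on_bary)

lemma affine_sum: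
  assumes "sum u V = 1"
  shows "a \<bullet> (\<Sum>w\<in>V. u w *\<^sub>R w) + b = (\<Sum>w\<in>V. u w * (a \<bullet> w + b))"
  using assms by (simp add: inner_sum_right distrib_left sum.distrib flip: sum_distrib_right)

text \<open>An affine function commutes with combinations of total weight 1, and
  \<open>bary V v\<close> kills every vertex but \<open>v\<close>.\<close>

lemma bary_unique:
  assumes "affine_basis V" "sum u V = 1" "(\<Sum>w\<in>V. u w *\<^sub>R w) = x" "v \<in> V"
  shows "bary V v x = u v"
proof -
  obtain a b where ab: "\<And>x. bary V v x = a \<bullet> x + b"
    using bary_affine[OF assms(1)] by blast
  have "bary V v x = (\<Sum>w\<in>V. u w * bary V v w)"
    unfolding ab assms(3)[symmetric] by (rule affine_sum[OF assms(2)])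
  also have "\<dots> = (\<Sum>w\<in>V. if w = v then u w else 0)"
    using assms(1) by (intro sum.cong) (auto simp: bary_vertex)
  also have "\<dots> = u v"
    using assms(1,4) by (simp add: affine_basis_finite)
  finally show ?thesis .
qed

lemma bary_combination:
  assumes "affine_basis V"
  shows "sum (\<lambda>v. bary V v x) V = 1" "(\<Sum>v\<in>V. bary V v x *\<^sub>R v) = x"
proof -
  obtain u where u: "sum u V = 1" "(\<Sum>v\<in>V. u v *\<^sub>R v) = x"
  proof -
    have "x \<in> affine hull V" using affine_basis_affine_hull[OF assms] by simp
    then show thesis
      using that unfolding affine_hull_finite[OF affine_basis_finite[OF assms]] by blast
  qed
  have "u v = bary V v x" if "v \<in> V" for v
    using bary_unique[OF assms u that] by simp
  with u show "sum (\<lambda>v. bary V v x) V = 1" "(\<Sum>v\<in>V. bary V v x *\<^sub>R v) = x"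
    by (auto cong: sum.cong)
qed

lemma convex_hull_bary:
  assumes "affine_basis V"
  shows "x \<in> convex hull V \<longleftrightarrow> (\<forall>v\<in>V. bary V v x \<ge> 0)"
proof
  assume "x \<in> convex hull V"
  then obtain u where "\<forall>v\<in>V. 0 \<le> u v" "sum u V = 1" "(\<Sum>v\<in>V. u v *\<^sub>R v) = x"
    using convex_hull_finite[OF affine_basis_finite[OF assms]] by blast
  then show "\<forall>v\<in>V. bary V v x \<ge> 0"
    using bary_unique[OF assms] by metis
next
  assume "\<forall>v\<in>V. bary V v x \<ge> 0"
  then have "\<exists>u. (\<forall>v\<in>V. 0 \<le> u v) \<and> sum u V = 1 \<and> (\<Sum>v\<in>V. u v *\<^sub>R v) = x"
    using bary_combination[OF assms, of x] by (intro exI[of _ "\<lambda>v. bary V v x"]) simp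
  then show "x \<in> convex hull V"
    unfolding convex_hull_finite[OF affine_basis_finite[OF assms]] by simp
qed

lemma compact_convex_hull_basis: "affine_basis V \<Longrightarrow> compact (convex hull V)"
  by (rule finite_imp_compact_convex_hull) (rule affine_basis_finite)

lemma set_integrable_hull:
  fixes h :: "'a::euclidean_space \<Rightarrow> real"
  assumes "affine_basis V" "continuous_on UNIV h"
  shows "set_integrable lborel (convex hull V) h"
  unfolding set_integrable_def using compact_convex_hull_basis[OF assms(1)]
  by (rule borel_integrable_compact) (rule continuous_on_subset[OF assms(2)], simp)

text \<open>\<open>M\<close> is the affine extension of \<open>\<sigma>\<close>. The factor
  \<open>k\<close>, the reciprocal of the absolute determinant of its linear part, stays abstract
  because only quotients of integrals are used later.\<close>

lemma affine_basis_transfer: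
  fixes V W :: "'a::euclidean_space set"
  assumes V: "affine_basis V" and W: "affine_basis W" and \<sigma>: "bij_betw \<sigma> V W"
  obtains k M where "k > 0"
    "\<And>x v. v \<in> V \<Longrightarrow> bary W (\<sigma> v) (M x) = bary V v x"
    "\<And>h :: 'a \<Rightarrow> real. h \<in> borel_measurable borel \<Longrightarrow>
      (LINT x:convex hull V|lborel. h (M x)) = k * (LINT y:convex hull W|lborel. h y)"
proof -
  obtain g c where g: "linear g" "\<And>v. v \<in> V \<Longrightarrow> \<sigma> v = c + g v"
    using V affine_interpolation[of V \<sigma>] unfolding affine_basis_def by metis
  define M where "M x = c + g x" for x
  have M_sum: "M (\<Sum>v\<in>V. u v *\<^sub>R v) = (\<Sum>v\<in>V. u v *\<^sub>R \<sigma> v)" if "sum u V = 1" for u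
  proof -
    have "(\<Sum>v\<in>V. u v *\<^sub>R \<sigma> v) = (\<Sum>v\<in>V. u v *\<^sub>R c + u v *\<^sub>R g v)"
      by (intro sum.cong) (auto simp: g(2) scaleR_add_right)
    also have "\<dots> = c + (\<Sum>v\<in>V. u v *\<^sub>R g v)"
      using that by (simp add: sum.distrib flip: scaleR_sum_left)
    also have "\<dots> = M (\<Sum>v\<in>V. u v *\<^sub>R v)"
      by (simp add: M_def linear_sum[OF g(1)] linear_scale[OF g(1)])
    finally show ?thesis by simp
  qed
  have reindex: "(\<Sum>v\<in>V. f (\<sigma> v)) = sum f W" for f :: "'a \<Rightarrow> 'b::comm_monoid_add"
    using \<sigma> by (rule sum.reindex_bij_betw)
  \<comment> \<open>A preimage of \<open>y\<close> is the point that has, relative to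
    \<open>V\<close>, the coordinates of \<open>y\<close> relative to \<open>W\<close>. Surjectivity
    then makes the linear part injective, by finite dimension.\<close>
  have "surj M"
  proof (rule surjI)
    fix y
    have "sum (\<lambda>v. bary W (\<sigma> v) y) V = 1" "(\<Sum>v\<in>V. bary W (\<sigma> v) y *\<^sub>R \<sigma> v) = y"
      using bary_combination[OF W, of y] reindex[of "\<lambda>w. bary W w y"] reindex[of "\<lambda>w. bary W w y *\<^sub>R w"]
      by simp_all
    then show "M (\<Sum>v\<in>V. bary W (\<sigma> v) y *\<^sub>R v) = y"
      by (simp add: M_sum)
  qed
  have "surj g"
  proof (rule surjI)
    fix y show "g (inv M (c + y)) = y"
      using surj_f_inv_f[OF \<open>surj M\<close>, of "c + y"] by (simp add: M_def)
  qed
  then have "bij g"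
    using g(1) by (simp add: bij_def linear_surjective_imp_injective)
  have bary_M: "bary W (\<sigma> v) (M x) = bary V v x" if "v \<in> V" for v x
  proof -
    have inv: "the_inv_into V \<sigma> (\<sigma> w) = w" if "w \<in> V" for w
      using that \<sigma> by (simp add: bij_betw_def the_inv_into_f_f)
    \<comment> \<open>The coordinates of \<open>x\<close>, reindexed along \<open>\<sigma>\<close>,
      represent \<open>M x\<close>; uniqueness identifies them.\<close>
    define u where "u w = bary V (the_inv_into V \<sigma> w) x" for w
    have "sum u W = 1"
      using reindex[of u] bary_combination(1)[OF V, of x] by (simp add: u_def inv cong: sum.cong)
    moreover have "(\<Sum>w\<in>W. u w *\<^sub>R w) = M x"
      using reindex[of "\<lambda>w. u w *\<^sub>R w"] M_sum[of "\<lambda>v. bary V v x"] bary_combination[OF V, of x]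
      by (simp add: u_def inv cong: sum.cong)
    moreover have "\<sigma> v \<in> W" using \<sigma> that by (auto dest: bij_betwE)
    ultimately have "bary W (\<sigma> v) (M x) = u (\<sigma> v)"
      by (intro bary_unique[OF W])
    then show ?thesis by (simp add: u_def inv that)
  qed
  have hull: "M x \<in> convex hull W \<longleftrightarrow> x \<in> convex hull V" for x
    unfolding convex_hull_bary[OF V] convex_hull_bary[OF W]
    using bij_betw_ball[OF \<sigma>, of "\<lambda>w. 0 \<le> bary W w (M x)"] by (simp add: bary_M)
  obtain k where k: "k > 0" "distr lborel borel g = density lborel (\<lambda>_. ennreal k)"
    using lborel_distr_linear[OF g(1) \<open>bij g\<close>] .
  have gm[measurable]: "g \<in> borel_measurable borel"
    using g(1) by (simp add: borel_measurable_continuous_onI linear_continuous_on linear_conv_bounded_linear)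
  have [measurable]: "convex hull W \<in> sets borel"
    using compact_convex_hull_basis[OF W] by (rule borel_compact)
  have "(LINT x:convex hull V|lborel. h (M x)) = k * (LINT y:convex hull W|lborel. h y)"
    if [measurable]: "h \<in> borel_measurable borel" for h :: "'a \<Rightarrow> real"
  proof -
    define F where "F y = indicator (convex hull W) y * h y" for y
    have [measurable]: "F \<in> borel_measurable borel" unfolding F_def by measurable
    have "(LINT x:convex hull V|lborel. h (M x)) = (LINT x|lborel. F (c + g x))"
      unfolding set_lebesgue_integral_def F_def
      by (intro Bochner_Integration.integral_cong) (use hull in \<open>auto simp: M_def indicator_def\<close>)
    also have "\<dots> = (LINT y|distr lborel borel g. F (c + y))"
      by (subst integral_distr) auto
    also have "\<dots> = k * (LINT y|lborel. F (c + y))"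
      unfolding k(2) using k(1) by (subst integral_density) auto
    also have "(LINT y|lborel. F (c + y)) = (LINT y|distr lborel borel ((+) c). F y)"
      by (subst integral_distr) auto
    also have "\<dots> = (LINT y:convex hull W|lborel. h y)"
      by (simp add: lborel_distr_plus F_def set_lebesgue_integral_def)
    finally show ?thesis .
  qed
  with k(1) bary_M show ?thesis by (rule that)
qed

section \<open>Second moments of a simplex\<close>

lemma affine_basis_exists: "affine_basis (insert 0 (Basis :: 'a::euclidean_space set))"
proof -
  have "(\<lambda>x::'a. - 0 + x) ` (insert 0 Basis - {0}) = Basis" by auto
  then have "\<not> affine_dependent (insert 0 (Basis :: 'a set))"
    using affine_dependent_iff_dependent2[of 0 "insert 0 (Basis :: 'a set)"] independent_Basis
    by simp
  then show ?thesis by (simp add: affine_basis_def)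
qed

section \<open>Positivity of integrals over a simplex\<close>

lemma not_negligible_hull: "affine_basis V \<Longrightarrow> \<not> negligible (convex hull V)"
  unfolding negligible_convex_interior[OF convex_convex_hull]
  using rel_interior_interior[of "convex hull V"] rel_interior_eq_empty[of "convex hull V"]
    affine_basis_affine_hull[of V]
  by (auto simp: affine_hull_convex_hull)

lemma measure_hull_lborel:
  "affine_basis V \<Longrightarrow> measure lebesgue (convex hull V) = measure lborel (convex hull V)"
  by (rule measure_completion) (simp add: borel_compact compact_convex_hull_basis)

lemma measure_hull_pos:
  assumes "affine_basis V"
  shows "measure lborel (convex hull V) > 0"
proof -
  have "convex hull V \<in> lmeasurable"
    using assms by (intro lmeasurable_compact compact_convex_hull_basis)
  then have "measure lebesgue (convex hull V) \<noteq> 0"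
    using not_negligible_hull[OF assms] by (simp add: negligible_iff_measure)
  then show ?thesis
    by (simp add: measure_hull_lborel[OF assms] order_less_le)
qed

text \<open>Serves twice: for the strict positivity of moments, and for the equality case when two
  triangulations are compared.\<close>

lemma negligible_zero_of_integral_nonpos:
  fixes h :: "'a::euclidean_space \<Rightarrow> real"
  assumes "compact K" "continuous_on UNIV h"
    and nonneg: "\<And>x. x \<in> K \<Longrightarrow> h x \<ge> 0"
    and le: "(LINT x:K|lborel. h x) \<le> 0"
  shows "negligible {x \<in> K. h x \<noteq> 0}"
proof -
  let ?f = "\<lambda>x. indicator K x *\<^sub>R h x"
  have int: "integrable lborel ?f"
    using assms(1) by (rule borel_integrable_compact) (rule continuous_on_subset[OF assms(2)], simp)
  have "(LINT x|lborel. ?f x) \<ge> 0"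
    by (rule integral_nonneg_AE) (use nonneg in \<open>auto simp: indicator_def\<close>)
  with le have "(LINT x|lborel. ?f x) = 0"
    by (simp add: set_lebesgue_integral_def)
  then have "AE x in lborel. ?f x = 0"
    using integral_nonneg_eq_0_iff_AE[OF int] nonneg by (auto simp: indicator_def)
  then have "AE x in lebesgue. ?f x = 0"
    by (rule AE_completion)
  then obtain N where "negligible N" "{x. \<not> ?f x = 0} \<subseteq> N"
    unfolding eventually_ae_filter_negligible by blast
  moreover have "{x \<in> K. h x \<noteq> 0} \<subseteq> {x. \<not> ?f x = 0}" by auto
  ultimately show ?thesis
    by (meson negligible_subset order_trans)
qed

lemma hull_integral_pos:
  fixes h :: "'a::euclidean_space \<Rightarrow> real"
  assumes V: "affine_basis V" and "continuous_on UNIV h"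
    and "\<And>x. x \<in> convex hull V \<Longrightarrow> h x \<ge> 0"
    and neg: "negligible {x. h x = 0}"
  shows "(LINT x:convex hull V|lborel. h x) > 0"
proof (rule ccontr)
  assume "\<not> ?thesis"
  then have "negligible {x \<in> convex hull V. h x \<noteq> 0}"
    using assms by (intro negligible_zero_of_integral_nonpos compact_convex_hull_basis) auto
  from negligible_Un[OF neg this] have "negligible (convex hull V)"
    by (rule negligible_subset) auto
  then show False using not_negligible_hull[OF V] by simp
qed

lemma negligible_bary_zero:
  fixes V :: "'a::euclidean_space set"
  assumes V: "affine_basis V" and "u \<in> V"
  shows "negligible {x. bary V u x = 0}"
proof -
  obtain a b where ab: "\<And>x. bary V u x = a \<bullet> x + b"
    using bary_affine[OF V] by blast
  have "a \<noteq> 0 \<or> - b \<noteq> 0"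
    using ab[of u] bary_vertex[OF V \<open>u \<in> V\<close>, of u] by auto
  moreover have "{x. bary V u x = 0} = {x. a \<bullet> x = - b}"
    using ab by (auto simp: eq_neg_iff_add_eq_0)
  ultimately show ?thesis using negligible_hyperplane by metis
qed

lemma negligible_bary_eq:
  fixes V :: "'a::euclidean_space set"
  assumes V: "affine_basis V" and "u \<in> V" "v \<in> V" "u \<noteq> v"
  shows "negligible {x. bary V u x = bary V v x}"
proof -
  obtain a b where ab: "\<And>x. bary V u x = a \<bullet> x + b"
    using bary_affine[OF V] by blast
  obtain a' b' where ab': "\<And>x. bary V v x = a' \<bullet> x + b'"
    using bary_affine[OF V] by blast
  have "a - a' \<noteq> 0 \<or> b' - b \<noteq> 0"
    using ab[of u] ab'[of u] bary_vertex[OF V \<open>u \<in> V\<close>] assms(4) by auto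
  moreover have "{x. bary V u x = bary V v x} = {x. (a - a') \<bullet> x = b' - b}"
    using ab ab' by (auto simp: inner_diff_left)
  ultimately show ?thesis using negligible_hyperplane by metis
qed

definition moment :: "'a::euclidean_space set \<Rightarrow> 'a \<Rightarrow> 'a \<Rightarrow> real" where
  "moment V u v = (LINT x:convex hull V|lborel. bary V u x * bary V v x)"

lemma continuous_on_bary_mult:
  "affine_basis V \<Longrightarrow> continuous_on A (\<lambda>x. bary V u x * bary V v x)"
  by (intro continuous_on_mult continuous_on_bary)

lemma moment_pos:
  assumes V: "affine_basis V" and "u \<in> V" "v \<in> V"
  shows "moment V u v > 0"
  unfolding moment_def
proof (rule hull_integral_pos[OF V])
  show "negligible {x. bary V u x * bary V v x = 0}"
  proof -
    have "{x. bary V u x * bary V v x = 0} = {x. bary V u x = 0} \<union> {x. bary V v x = 0}" by auto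
    then show ?thesis using negligible_bary_zero[OF V] assms by simp
  qed
qed (use assms in \<open>auto simp: convex_hull_bary intro: continuous_on_bary_mult\<close>)

text \<open>Expand the integral of the square of \<open>bary V u x - bary V v x\<close>, which is
  positive because two coordinates agree only on a null set. The two diagonal moments are kept apart
  here; their equality follows from \<open>moment_transfer\<close>.\<close>

lemma moment_diag_gt:
  assumes V: "affine_basis V" and uv: "u \<in> V" "v \<in> V" "u \<noteq> v"
  shows "moment V u u + moment V v v > 2 * moment V u v"
proof -
  have int: "set_integrable lborel (convex hull V) (\<lambda>x. bary V u x * bary V v x)" for u v
    using V by (intro set_integrable_hull continuous_on_bary_mult)
  have "0 < (LINT x:convex hull V|lborel. (bary V u x - bary V v x) * (bary V u x - bary V v x))"
    using negligible_bary_eq[OF V uv]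
    by (intro hull_integral_pos[OF V] continuous_on_mult continuous_on_diff continuous_on_bary[OF V])
      (auto simp flip: power2_eq_square)
  also have "\<dots> = (LINT x:convex hull V|lborel. (bary V u x * bary V u x + bary V v x * bary V v x)
      - (bary V u x * bary V v x + bary V u x * bary V v x))"
    by (simp add: algebra_simps)
  also have "\<dots> = moment V u u + moment V v v - 2 * moment V u v"
    using int by (simp add: set_integral_diff set_integral_add moment_def)
  finally show ?thesis by simp
qed

text \<open>Moment and volume are scaled by the same \<open>k\<close>, which cancels.\<close>

lemma moment_transfer:
  fixes V W :: "'a::euclidean_space set"
  assumes V: "affine_basis V" and W: "affine_basis W" and \<sigma>: "bij_betw \<sigma> V W"
    and "u \<in> V" "v \<in> V"
  shows "moment V u v / measure lborel (convex hull V) =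
    moment W (\<sigma> u) (\<sigma> v) / measure lborel (convex hull W)"
proof -
  obtain k M where k: "k > 0"
    and M: "\<And>x v. v \<in> V \<Longrightarrow> bary W (\<sigma> v) (M x) = bary V v x"
    and I: "\<And>h :: 'a \<Rightarrow> real. h \<in> borel_measurable borel \<Longrightarrow>
      (LINT x:convex hull V|lborel. h (M x)) = k * (LINT y:convex hull W|lborel. h y)"
    using affine_basis_transfer[OF V W \<sigma>] by metis
  have "moment V u v = k * moment W (\<sigma> u) (\<sigma> v)"
    using I[of "\<lambda>y. bary W (\<sigma> u) y * bary W (\<sigma> v) y"] borel_measurable_bary[OF W] assms(4,5)
    by (simp add: M moment_def)
  moreover have "measure lborel (convex hull V) = k * measure lborel (convex hull W)"
    using I[of "\<lambda>y. 1"] by (simp add: set_lebesgue_integral_def compact_convex_hull_basis[OF V] compact_convex_hull_basis[OF W] borel_compact)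
  ultimately show ?thesis using k by simp
qed

lemma bij_betw_two_points:
  assumes "finite V" "finite W" "card V = card W" "u \<in> V" "v \<in> V" "u \<noteq> v" "u' \<in> W" "v' \<in> W" "u' \<noteq> v'"
  obtains \<sigma> where "bij_betw \<sigma> V W" "\<sigma> u = u'" "\<sigma> v = v'"
proof -
  have "card (V - {u, v}) = card (W - {u', v'})"
    using assms by (simp add: card_Diff_subset)
  then obtain \<tau> where \<tau>: "bij_betw \<tau> (V - {u, v}) (W - {u', v'})"
    using assms finite_same_card_bij[of "V - {u, v}" "W - {u', v'}"] by auto
  let ?\<sigma> = "\<tau>(u := u', v := v')"
  have "bij_betw ?\<sigma> ((V - {u, v}) \<union> {u, v}) ((W - {u', v'}) \<union> {u', v'})"
  proof (rule bij_betw_combine)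
    show "bij_betw ?\<sigma> (V - {u, v}) (W - {u', v'})"
      using \<tau> by (rule bij_betw_cong[THEN iffD1, rotated]) auto
    show "bij_betw ?\<sigma> {u, v} {u', v'}"
      using assms by (auto simp: bij_betw_def inj_on_def)
  qed auto
  moreover have "(V - {u, v}) \<union> {u, v} = V" "(W - {u', v'}) \<union> {u', v'} = W"
    using assms by auto
  ultimately show ?thesis
    using that[of ?\<sigma>] assms by simp
qed

text \<open>Some bijection of vertex sets carries any ordered pair of distinct vertices to any
  other, so the pair \<open>0\<close>, \<open>w'\<close> of the standard simplex \<open>W\<close>
  determines all moments.\<close>

lemma moments_universal:
  obtains a b :: real where "b > 0" "a > b"
    "\<And>(V :: 'a::euclidean_space set) u. affine_basis V \<Longrightarrow> u \<in> V \<Longrightarrow>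
      moment V u u = a * measure lborel (convex hull V)"
    "\<And>(V :: 'a set) u v. affine_basis V \<Longrightarrow> u \<in> V \<Longrightarrow> v \<in> V \<Longrightarrow> u \<noteq> v \<Longrightarrow>
      moment V u v = b * measure lborel (convex hull V)"
proof -
  define W :: "'a set" where "W = insert 0 Basis"
  have W: "affine_basis W" unfolding W_def by (rule affine_basis_exists)
  obtain w' :: 'a where w': "w' \<in> Basis" using nonempty_Basis by blast
  have w: "0 \<in> W" "w' \<in> W" "0 \<noteq> w'" using w' by (auto simp: W_def)
  define a where "a = moment W 0 0 / measure lborel (convex hull W)"
  define b where "b = moment W 0 w' / measure lborel (convex hull W)"
  have diag: "moment V u u / measure lborel (convex hull V) = a"
    and off: "v \<in> V \<Longrightarrow> u \<noteq> v \<Longrightarrow> moment V u v / measure lborel (convex hull V) = b"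
    if V: "affine_basis V" and u: "u \<in> V" for V :: "'a set" and u v
  proof -
    have card: "finite V" "finite W" "card V = card W" and card2: "card V = DIM('a) + 1"
      using V W by (auto simp: affine_basis_def affine_basis_finite)
    show *: "moment V u v / measure lborel (convex hull V) = b" if v: "v \<in> V" "u \<noteq> v" for v
    proof -
      obtain \<sigma> where "bij_betw \<sigma> V W" "\<sigma> u = 0" "\<sigma> v = w'"
        using bij_betw_two_points[OF card u v w] .
      then show ?thesis using moment_transfer[OF V W _ u \<open>v \<in> V\<close>] by (simp add: b_def)
    qed
    \<comment> \<open>The bijection lemma works with pairs, so the diagonal case needs a second
      vertex; it exists because the dimension is positive.\<close>
    have "card (V - {u}) = DIM('a)" using card(1) card2 u by simp
    then have "card (V - {u}) > 0" by simp
    then obtain v where v: "v \<in> V" "u \<noteq> v" by (auto simp: card_gt_0_iff)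
    obtain \<sigma> where "bij_betw \<sigma> V W" "\<sigma> u = 0" "\<sigma> v = w'"
      using bij_betw_two_points[OF card u v w] .
    then show "moment V u u / measure lborel (convex hull V) = a"
      using moment_transfer[OF V W _ u u] by (simp add: a_def)
  qed
  have "b > 0" using moment_pos[OF W w(1,2)] measure_hull_pos[OF W] by (simp add: b_def)
  moreover have "a > b"
  proof -
    \<comment> \<open>Applied inside \<open>W\<close> itself, \<open>diag\<close> equates the
      moments at \<open>w'\<close> and at \<open>0\<close>, so \<open>moment_diag_gt\<close> becomes
      \<open>a > b\<close>.\<close>
    have "moment W w' w' / measure lborel (convex hull W) = a" by (rule diag[OF W w(2)])
    then have "moment W w' w' = moment W 0 0"
      using measure_hull_pos[OF W] by (simp add: a_def)
    then have "moment W 0 0 > moment W 0 w'"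
      using moment_diag_gt[OF W w] by simp
    then show ?thesis
      using measure_hull_pos[OF W] by (simp add: a_def b_def divide_strict_right_mono)
  qed
  ultimately show thesis
  proof (rule that)
    fix V :: "'a set" and u assume V: "affine_basis V" "u \<in> V"
    then show "moment V u u = a * measure lborel (convex hull V)"
      using diag[OF V] measure_hull_pos[OF V(1)] by (simp add: field_simps)
  next
    fix V :: "'a set" and u v assume V: "affine_basis V" "u \<in> V" "v \<in> V" "u \<noteq> v"
    then show "moment V u v = b * measure lborel (convex hull V)"
      using off[OF V] measure_hull_pos[OF V(1)] by (simp add: field_simps)
  qed
qed

section \<open>The barycenter term of a single simplex\<close>

definition interp :: "'a::euclidean_space set \<Rightarrow> 'a \<Rightarrow> real" where
  "interp V x = (\<Sum>v\<in>V. bary V v x * (norm v)\<^sup>2)"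

lemma continuous_on_interp: "affine_basis V \<Longrightarrow> continuous_on A (interp V)"
  unfolding interp_def by (intro continuous_on_sum continuous_on_mult continuous_on_bary continuous_on_const)

lemma barycenter_term:
  obtains A B :: real where "B > 0"
    "\<And>V :: 'a::euclidean_space set. affine_basis V \<Longrightarrow>
      (norm ((1 / real (DIM('a) + 1)) *\<^sub>R \<Sum>V))\<^sup>2 * measure lborel (convex hull V) =
      A * (LINT x:convex hull V|lborel. (norm x)\<^sup>2) - B * (LINT x:convex hull V|lborel. interp V x)"
proof -
  obtain a b :: real where b: "b > 0" "a > b"
    and diag: "\<And>(V :: 'a set) u. affine_basis V \<Longrightarrow> u \<in> V \<Longrightarrow>
      moment V u u = a * measure lborel (convex hull V)"
    and off: "\<And>(V :: 'a set) u v. affine_basis V \<Longrightarrow> u \<in> V \<Longrightarrow> v \<in> V \<Longrightarrow> u \<noteq> v \<Longrightarrow>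
      moment V u v = b * measure lborel (convex hull V)"
    using moments_universal[where 'a = 'a] by metis
  \<comment> \<open>This is \<open>a + d * b\<close>, a row sum of the moments divided by the
    volume. Since the coordinates add up to 1, it is the mean of one coordinate over the
    simplex.\<close>
  define e where "e = (a - b) + real (DIM('a) + 1) * b"
  have "e > 0" unfolding e_def using b by (intro add_pos_pos) auto
  define q where "q = 1 / real (DIM('a) + 1)"
  have "q > 0" by (simp add: q_def)
  show thesis
  \<comment> \<open>The order is \<open>B\<close>, then \<open>A\<close>; the values come from
    solving the integral formulas \<open>two\<close> and \<open>three\<close> for the squared norm
    of the vertex sum.\<close>
  proof (rule that[of "q\<^sup>2 / b * ((a - b) / e)" "q\<^sup>2 / b"])
    show "0 < q\<^sup>2 / b * ((a - b) / e)" using b \<open>e > 0\<close> \<open>q > 0\<close> by simp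
  next
    fix V :: "'a set" assume V: "affine_basis V"
    note fin = affine_basis_finite[OF V]
    have card: "card V = DIM('a) + 1" using V by (simp add: affine_basis_def)
    let ?m = "measure lborel (convex hull V)"
    have int: "set_integrable lborel (convex hull V) (\<lambda>x. bary V u x * bary V v x)" for u v
      using V by (intro set_integrable_hull continuous_on_bary_mult)
    have int1: "set_integrable lborel (convex hull V) (bary V u)" for u
      using V by (intro set_integrable_hull continuous_on_bary)
    have mom: "moment V u v = ?m * (b + (if u = v then a - b else 0))" if "u \<in> V" "v \<in> V" for u v
      using diag[OF V] off[OF V] that by (auto simp: algebra_simps)
    have one: "(LINT x:convex hull V|lborel. bary V u x) = e * ?m" if "u \<in> V" for u
    proof -
      have "bary V u x = (\<Sum>v\<in>V. bary V u x * bary V v x)" for x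
        using bary_combination(1)[OF V, of x] by (simp flip: sum_distrib_left)
      then have "(LINT x:convex hull V|lborel. bary V u x) =
          (LINT x:convex hull V|lborel. (\<Sum>v\<in>V. bary V u x * bary V v x))" by simp
      also have "\<dots> = (\<Sum>v\<in>V. moment V u v)"
        unfolding moment_def set_lebesgue_integral_def using int
        by (simp add: sum_distrib_left set_integrable_def)
      also have "\<dots> = (\<Sum>v\<in>V. ?m * (b + (if u = v then a - b else 0)))"
        using that by (intro sum.cong) (auto simp: mom)
      also have "\<dots> = ?m * (\<Sum>v\<in>V. b + (if u = v then a - b else 0))"
        by (simp add: sum_distrib_left)
      also have "\<dots> = e * ?m"
        using fin that by (simp add: sum.distrib card e_def)
      finally show ?thesis .
    qed
    have two: "(LINT x:convex hull V|lborel. interp V x) = e * ?m * (\<Sum>v\<in>V. (norm v)\<^sup>2)"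
    proof -
      have "(LINT x:convex hull V|lborel. interp V x) =
          (\<Sum>v\<in>V. (LINT x:convex hull V|lborel. bary V v x) * (norm v)\<^sup>2)"
        unfolding interp_def set_lebesgue_integral_def using int1
        by (simp add: sum_distrib_left set_integrable_def mult.assoc[symmetric])
      also have "\<dots> = e * ?m * (\<Sum>v\<in>V. (norm v)\<^sup>2)"
        by (simp add: one sum_distrib_left cong: sum.cong)
      finally show ?thesis .
    qed
    have three: "(LINT x:convex hull V|lborel. (norm x)\<^sup>2) =
        ?m * (b * (norm (\<Sum>V))\<^sup>2 + (a - b) * (\<Sum>v\<in>V. (norm v)\<^sup>2))"
    proof -
      have sq: "(norm (\<Sum>v\<in>V. f v *\<^sub>R v))\<^sup>2 = (\<Sum>u\<in>V. \<Sum>v\<in>V. f u * f v * (u \<bullet> v))" for f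
        unfolding power2_norm_eq_inner inner_sum_left inner_sum_right by (simp add: mult_ac inner_commute)
      have "(norm x)\<^sup>2 = (\<Sum>u\<in>V. \<Sum>v\<in>V. bary V u x * bary V v x * (u \<bullet> v))" for x
        using sq[of "\<lambda>v. bary V v x"] by (simp add: bary_combination(2)[OF V])
      then have "(LINT x:convex hull V|lborel. (norm x)\<^sup>2) =
          (LINT x:convex hull V|lborel. (\<Sum>u\<in>V. \<Sum>v\<in>V. bary V u x * bary V v x * (u \<bullet> v)))"
        by simp
      also have "\<dots> = (\<Sum>u\<in>V. \<Sum>v\<in>V. moment V u v * (u \<bullet> v))"
        unfolding moment_def set_lebesgue_integral_def using int
        by (simp add: sum_distrib_left set_integrable_def mult.assoc[symmetric])
      also have "\<dots> = (\<Sum>u\<in>V. \<Sum>v\<in>V. ?m * (b * (u \<bullet> v) + (if u = v then (a - b) * (u \<bullet> v) else 0)))"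
        by (intro sum.cong) (auto simp: mom algebra_simps)
      also have "\<dots> = ?m * (b * (\<Sum>u\<in>V. \<Sum>v\<in>V. u \<bullet> v) + (a - b) * (\<Sum>v\<in>V. v \<bullet> v))"
        using fin by (simp add: sum.distrib sum_distrib_left[symmetric])
      also have "(\<Sum>u\<in>V. \<Sum>v\<in>V. u \<bullet> v) = (norm (\<Sum>V))\<^sup>2"
        using sq[of "\<lambda>_. 1"] by simp
      finally show ?thesis by (simp add: power2_norm_eq_inner)
    qed
    have "(norm (q *\<^sub>R \<Sum>V))\<^sup>2 * ?m = q\<^sup>2 * ((norm (\<Sum>V))\<^sup>2 * ?m)"
      by (simp add: power_mult_distrib)
    also have "(norm (\<Sum>V))\<^sup>2 * ?m = 1 / b * ((LINT x:convex hull V|lborel. (norm x)\<^sup>2)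
        - (a - b) / e * (LINT x:convex hull V|lborel. interp V x))"
      unfolding two three using b \<open>e > 0\<close> by (simp add: field_simps)
    also have "q\<^sup>2 * \<dots> = q\<^sup>2 / b * (LINT x:convex hull V|lborel. (norm x)\<^sup>2)
        - q\<^sup>2 / b * ((a - b) / e) * (LINT x:convex hull V|lborel. interp V x)"
    proof -
      define c where "c = (a - b) / e"
      show ?thesis unfolding c_def[symmetric] by (simp add: right_diff_distrib)
    qed
    finally show "(norm ((1 / real (DIM('a) + 1)) *\<^sub>R \<Sum>V))\<^sup>2 * ?m = \<dots>"
      by (simp add: q_def)
  qed
qed

section \<open>The Delaunay triangulation\<close>

text \<open>A dependent \<open>T\<close> lies in a hyperplane, while \<open>S\<close>, which spans,
  has a point off it. Some sphere through \<open>T\<close> also passes through that point, which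
  makes d + 2 cospherical points.\<close>

lemma generic_affine_basis:
  fixes S :: "'a::euclidean_space set"
  assumes S: "generic_points S" and T: "T \<subseteq> S" "card T = DIM('a) + 1" "\<And>p. p \<in> T \<Longrightarrow> norm (c - p) = r"
  shows "affine_basis T"
proof (rule ccontr)
  assume "\<not> affine_basis T"
  have fin: "finite T" using T(2) by (metis Suc_eq_plus1 card.infinite nat.distinct(1))
  have "aff_dim T \<noteq> int (card T) - 1"
    using \<open>\<not> affine_basis T\<close> T(2) fin by (auto simp: affine_basis_def affine_independent_iff_card)
  then have "aff_dim T < int DIM('a)"
    using aff_dim_le_card[OF fin] T(2) by simp
  then obtain a b where ab: "a \<noteq> 0" "T \<subseteq> {x. a \<bullet> x = b}"
    using aff_lowdim_subset_hyperplane by blast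
  obtain q where q: "q \<in> S" "a \<bullet> q \<noteq> b"
  proof (rule ccontr)
    assume "\<not> thesis"
    then have "S \<subseteq> {x. a \<bullet> x = b}" using that by blast
    then have "affine hull S \<subseteq> {x. a \<bullet> x = b}"
      by (rule hull_minimal) (rule affine_hyperplane)
    then have "a \<bullet> x = b" for x using S by (auto simp: generic_points_def)
    from this[of 0] this[of a] show False using ab(1) by simp
  qed
  have "q \<notin> T" using q ab by blast
  \<comment> \<open>Sliding the centre along the normal of the hyperplane through \<open>T\<close> gives a sphere through \<open>q\<close> too.\<close>
  define s where "s = ((norm (c - q))\<^sup>2 - r\<^sup>2) / (2 * (a \<bullet> q - b))"
  define c' where "c' = c + s *\<^sub>R a"
  have exp: "(norm (c' - x))\<^sup>2 = (norm (c - x))\<^sup>2 + 2 * s * (a \<bullet> c - a \<bullet> x) + s\<^sup>2 * (a \<bullet> a)" for x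
    unfolding c'_def power2_norm_eq_inner
    by (simp add: inner_add_left inner_add_right inner_diff_left inner_diff_right inner_commute power2_eq_square algebra_simps)
  \<comment> \<open>The term quadratic in \<open>s\<close> is the same for every point, so equating
    the squared distances to \<open>q\<close> and to \<open>T\<close> is a linear equation for
    \<open>s\<close>; \<open>R\<close> is the common value.\<close>
  define R where "R = r\<^sup>2 + 2 * s * (a \<bullet> c - b) + s\<^sup>2 * (a \<bullet> a)"
  have "(norm (c' - x))\<^sup>2 = R" if "x \<in> insert q T" for x
  proof (cases "x = q")
    case True
    define d where "d = a \<bullet> q - b"
    have "2 * s * d = (norm (c - q))\<^sup>2 - r\<^sup>2"
    proof -
      have "d \<noteq> 0" using q(2) by (simp add: d_def)
      then show ?thesis unfolding s_def d_def[symmetric] by simp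
    qed
    then show ?thesis unfolding True exp R_def d_def by (simp add: algebra_simps)
  next
    case False
    then show ?thesis using that T(3) ab(2) unfolding exp R_def by auto
  qed
  then have "insert q T \<subseteq> sphere c' (sqrt R)"
    by (force simp: dist_norm intro: real_sqrt_unique[symmetric])
  moreover have "card (insert q T) = DIM('a) + 2" "insert q T \<subseteq> S"
    using fin \<open>q \<notin> T\<close> T q by auto
  ultimately show False using S unfolding generic_points_def by blast
qed

lemma generic_card_sphere:
  fixes S :: "'a::euclidean_space set"
  assumes S: "generic_points S" and "T \<subseteq> S" "\<And>p. p \<in> T \<Longrightarrow> norm (c - p) = r"
  shows "card T \<le> DIM('a) + 1"
proof (rule ccontr)
  assume "\<not> ?thesis"
  then have "DIM('a) + 2 \<le> card T" by simp
  then obtain U where "U \<subseteq> T" "card U = DIM('a) + 2"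
    by (rule obtain_subset_with_card_n)
  moreover have "T \<subseteq> sphere c r" using assms(3) by (auto simp: dist_norm)
  ultimately show False using S \<open>T \<subseteq> S\<close> unfolding generic_points_def by blast
qed

text \<open>A common point of the Voronoi cells is the centre of an empty circumscribed sphere. The
  strict inequality is genericity: one more point of \<open>S\<close> at distance \<open>r\<close>
  would be the (d + 2)nd on that sphere.\<close>

lemma delaunayE:
  fixes S :: "'a::euclidean_space set"
  assumes S: "generic_points S" and "D \<in> delaunay S"
  obtains T c r where "D = convex hull T" "T \<subseteq> S" "affine_basis T"
    "\<And>p. p \<in> T \<Longrightarrow> norm (c - p) = r" "\<And>q. q \<in> S - T \<Longrightarrow> r < norm (c - q)"
proof -
  obtain T c where T: "D = convex hull T" "T \<subseteq> S" "card T = DIM('a) + 1"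
    and c: "\<And>p. p \<in> T \<Longrightarrow> c \<in> voronoi_cell S p"
    using assms(2) unfolding delaunay_def by blast
  obtain p0 where "p0 \<in> T" using T(3) by fastforce
  define r where "r = norm (c - p0)"
  have ge: "r \<le> norm (c - q)" if "q \<in> S" for q
    using c[OF \<open>p0 \<in> T\<close>] that by (auto simp: voronoi_cell_def r_def)
  have eq: "norm (c - p) = r" if "p \<in> T" for p
    using c[OF that] ge[of p] T(2) \<open>p0 \<in> T\<close> that by (force simp: voronoi_cell_def r_def)
  have "r < norm (c - q)" if q: "q \<in> S - T" for q
  proof (rule ccontr)
    assume "\<not> ?thesis"
    then have "norm (c - q) = r" using ge[of q] q by simp
    then have "card (insert q T) \<le> DIM('a) + 1"
      using q T(2) eq by (intro generic_card_sphere[OF S, of _ c r]) auto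
    then show False using q T(3) by (simp add: card_insert_if card_ge_0_finite)
  qed
  with T eq generic_affine_basis[OF S T(2,3)] show thesis
    using that by blast
qed

lemma delaunayI:
  fixes S :: "'a::euclidean_space set"
  assumes "T \<subseteq> S" "card T = DIM('a) + 1"
    "\<And>p. p \<in> T \<Longrightarrow> norm (c - p) = r" "\<And>q. q \<in> S \<Longrightarrow> r \<le> norm (c - q)"
  shows "convex hull T \<in> delaunay S"
proof -
  have "c \<in> (\<Inter>p\<in>T. voronoi_cell S p)"
    using assms(3,4) by (auto simp: voronoi_cell_def)
  then show ?thesis unfolding delaunay_def using assms(1,2) by blast
qed

section \<open>The Delaunay simplices cover the convex hull\<close>

lemma negligible_affine_hull_small:
  fixes U :: "'a::euclidean_space set"
  assumes "finite U" "card U \<le> DIM('a)"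
  shows "negligible (affine hull U)"
proof -
  have "aff_dim U < int DIM('a)"
    using aff_dim_le_card[OF assms(1)] assms(2) by simp
  then obtain a b where "a \<noteq> 0" "U \<subseteq> {x. a \<bullet> x = b}"
    using aff_lowdim_subset_hyperplane by blast
  then have "affine hull U \<subseteq> {x. a \<bullet> x = b}"
    by (intro hull_minimal affine_hyperplane)
  with \<open>a \<noteq> 0\<close> show ?thesis
    using negligible_hyperplane negligible_subset by blast
qed

text \<open>A point of the lower boundary of the hull of the lifted points \<open>(p, (norm p)\<^sup>2)\<close> has a
  supporting hyperplane; it is not vertical because \<open>x\<close> is interior, so it cuts the paraboloid
  over a sphere.\<close>

lemma supporting_paraboloid:
  fixes S :: "'a::euclidean_space set"
  assumes "finite S" and x: "x \<in> interior (convex hull S)"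
  obtains c r where "\<And>q. q \<in> S \<Longrightarrow> r \<le> norm (c - q)"
    "x \<in> convex hull {p \<in> S. norm (c - p) = r}"
proof -
  define L where "L p = (p, (norm p)\<^sup>2)" for p :: 'a
  define P where "P = convex hull (L ` S)"
  have finL: "finite (L ` S)" using assms(1) by simp
  have cP: "compact P" "convex P"
    unfolding P_def using finL by (auto intro: finite_imp_compact_convex_hull)
  have fstP: "fst ` (convex hull (L ` A)) = convex hull A" for A
    by (simp add: convex_hull_linear_image[OF linear_fst] image_image L_def)
  define Q where "Q = P \<inter> {y. fst y = x}"
  have "x \<in> fst ` P" using x interior_subset fstP[of S] unfolding P_def by blast
  then have "Q \<noteq> {}" by (auto simp: Q_def)
  moreover have "compact Q" unfolding Q_def
    by (intro compact_Int_closed cP closed_Collect_eq continuous_intros)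
  moreover have "continuous_on Q snd" by (intro continuous_intros)
  ultimately obtain y where y: "y \<in> Q" "\<And>y'. y' \<in> Q \<Longrightarrow> snd y \<le> snd y'"
    using continuous_attains_inf[of Q snd] by blast
  define z where "z = snd y"
  have xz: "(x, z) \<in> P" using y(1) by (auto simp: Q_def z_def)
  have min: "z \<le> z'" if "(x, z') \<in> P" for z'
    using y(2)[of "(x, z')"] that by (simp add: Q_def z_def)
  \<comment> \<open>The open vertical ray below the lowest point \<open>(x, z)\<close> of
    \<open>P\<close> over \<open>x\<close> misses \<open>P\<close>; separating the two yields a
    hyperplane supporting \<open>P\<close> at \<open>(x, z)\<close>.\<close>
  have "P \<inter> ({x} \<times> {..<z}) = {}" using min by force
  moreover have "{x} \<times> {..<z} \<noteq> {}" by auto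
  moreover have "convex ({x} \<times> {..<z})" by (intro convex_Times) auto
  ultimately obtain w \<beta> where w: "w \<noteq> 0" "\<And>y. y \<in> {x} \<times> {..<z} \<Longrightarrow> w \<bullet> y \<le> \<beta>"
      "\<And>y. y \<in> P \<Longrightarrow> \<beta> \<le> w \<bullet> y"
    using separating_hyperplane_sets[of "{x} \<times> {..<z}" P] cP(2) xz by (metis Int_commute empty_iff)
  obtain u s where us: "w = (u, s)" by (cases w)
  have low: "u \<bullet> x + s * z' \<le> \<beta>" if "z' < z" for z'
    using w(2)[of "(x, z')"] that by (simp add: us inner_mult_right)
  have up: "\<beta> \<le> u \<bullet> fst y + s * snd y" if "y \<in> P" for y
    using w(3)[OF that] by (simp add: us inner_prod_def)
  have "s \<ge> 0"
    using low[of "z - 1"] up[OF xz] by (simp add: algebra_simps)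
  \<comment> \<open>Let \<open>z'\<close> tend to \<open>z\<close> from below. The denominator
    \<open>s + 1\<close> also covers \<open>s = 0\<close>, not yet excluded.\<close>
  have at: "u \<bullet> x + s * z = \<beta>"
  proof (rule antisym)
    show "u \<bullet> x + s * z \<le> \<beta>"
    proof (rule field_le_epsilon)
      fix e :: real assume "e > 0"
      have "u \<bullet> x + s * (z - e / (s + 1)) \<le> \<beta>"
        using \<open>e > 0\<close> \<open>s \<ge> 0\<close> by (intro low) (simp add: divide_pos_pos)
      moreover have "s * (e / (s + 1)) \<le> e"
        using \<open>e > 0\<close> \<open>s \<ge> 0\<close> by (simp add: field_simps)
      ultimately show "u \<bullet> x + s * z \<le> \<beta> + e" by (simp add: algebra_simps)
    qed
  qed (use up[OF xz] in simp)
  \<comment> \<open>For \<open>s = 0\<close> the functional \<open>u\<close> would attain its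
    minimum over the hull at the interior point \<open>x\<close>, but \<open>x\<close> can be moved
    against \<open>u\<close>.\<close>
  have "s \<noteq> 0"
  proof
    assume "s = 0"
    then have "u \<noteq> 0" using w(1) us by (auto simp: zero_prod_def)
    have "u \<bullet> x \<le> u \<bullet> v" if "v \<in> convex hull S" for v
      using that up at \<open>s = 0\<close> fstP[of S] unfolding P_def by fastforce
    moreover obtain e where e: "e > 0" "ball x e \<subseteq> convex hull S"
      using x by (auto simp: mem_interior)
    moreover have "x - (e / 2 / norm u) *\<^sub>R u \<in> ball x e"
      using e(1) \<open>u \<noteq> 0\<close> by (simp add: dist_norm)
    ultimately have "u \<bullet> x \<le> u \<bullet> (x - (e / 2 / norm u) *\<^sub>R u)" by blast
    then have "e / 2 / norm u * (u \<bullet> u) \<le> 0"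
      by (simp add: inner_diff_right)
    moreover have "e / 2 / norm u * (u \<bullet> u) > 0"
      using e(1) \<open>u \<noteq> 0\<close> by (intro mult_pos_pos) auto
    ultimately show False by simp
  qed
  with \<open>s \<ge> 0\<close> have "s > 0" by simp
  \<comment> \<open>Divide \<open>u \<bullet> p + s * (norm p)\<^sup>2\<close> by \<open>s\<close>
    and complete the square: \<open>c\<close> is the resulting centre, and the value
    \<open>\<beta>\<close> corresponds to distance \<open>r\<close>.\<close>
  define c where "c = - (1 / (2 * s)) *\<^sub>R u"
  define r where "r = sqrt (\<beta> / s + c \<bullet> c)"
  have sq: "(norm (c - p))\<^sup>2 = (u \<bullet> p + s * (norm p)\<^sup>2) / s + c \<bullet> c" for p
    unfolding c_def power2_norm_eq_inner using \<open>s > 0\<close>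
    by (simp add: inner_add_left inner_add_right inner_diff_left inner_diff_right inner_commute field_simps)
  have tight: "norm (c - p) = r" if "u \<bullet> p + s * (norm p)\<^sup>2 = \<beta>" for p
    using sq[of p] that unfolding r_def by (metis norm_ge_zero real_sqrt_unique)
  have ge: "r \<le> norm (c - q)" if "q \<in> S" for q
  proof -
    have "\<beta> \<le> u \<bullet> q + s * (norm q)\<^sup>2"
      using up[of "L q"] that by (simp add: P_def L_def hull_inc)
    then have "\<beta> / s + c \<bullet> c \<le> (norm (c - q))\<^sup>2"
      using \<open>s > 0\<close> unfolding sq by (simp add: divide_right_mono)
    then show ?thesis unfolding r_def by (simp add: real_le_lsqrt)
  qed
  \<comment> \<open>The face cut out by the hyperplane is spanned by lifted points of
    \<open>S\<close> in it, and these lie over points at distance exactly \<open>r\<close> from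
    \<open>c\<close>.\<close>
  have "(P \<inter> {y. w \<bullet> y = \<beta>}) face_of P"
    using cP(2) w(3) by (rule face_of_Int_supporting_hyperplane_ge)
  then obtain A where A: "A \<subseteq> L ` S" "P \<inter> {y. w \<bullet> y = \<beta>} = convex hull A"
    using face_of_convex_hull_subset[of "L ` S"] finite_imp_compact[OF finL] unfolding P_def by metis
  obtain T where T: "T \<subseteq> S" "A = L ` T" using A(1) by (meson subset_image_iff)
  have "(x, z) \<in> convex hull A"
    unfolding A(2)[symmetric] using xz at by (simp add: us)
  then have "x \<in> convex hull T"
    using fstP[of T] T(2) by (metis fst_conv imageI)
  moreover have "T \<subseteq> {p \<in> S. norm (c - p) = r}"
  proof
    fix p assume "p \<in> T"
    then have "L p \<in> P \<inter> {y. w \<bullet> y = \<beta>}"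
      unfolding A(2) T(2) by (simp add: hull_inc)
    then show "p \<in> {p \<in> S. norm (c - p) = r}"
      using T(1) \<open>p \<in> T\<close> by (auto simp: us L_def intro: tight)
  qed
  ultimately have "x \<in> convex hull {p \<in> S. norm (c - p) = r}"
    using hull_mono by blast
  with ge show thesis by (rule that)
qed

lemma interior_convex_hull_generic:
  assumes "generic_points S"
  shows "interior (convex hull S) \<noteq> {}"
proof -
  have "affine hull (convex hull S) = UNIV"
    using assms by (simp add: generic_points_def affine_hull_convex_hull)
  moreover from this have "convex hull S \<noteq> {}"
    by (metis affine_hull_empty empty_not_UNIV)
  ultimately show ?thesis
    using rel_interior_interior[of "convex hull S"] rel_interior_eq_empty[of "convex hull S"] by auto
qed

lemma finite_delaunay: "generic_points S \<Longrightarrow> finite (delaunay S)"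
  unfolding delaunay_def generic_points_def
  by (rule finite_subset[of _ "(\<lambda>T. convex hull T) ` Pow S"]) auto

lemma delaunay_cover:
  fixes S :: "'a::euclidean_space set"
  assumes S: "generic_points S"
  shows "\<Union>(delaunay S) = convex hull S"
proof
  show "\<Union>(delaunay S) \<subseteq> convex hull S"
    by (auto simp: delaunay_def intro: hull_mono[THEN subsetD])
  have fin: "finite S" using S by (simp add: generic_points_def)
  let ?I = "interior (convex hull S)"
  define N where "N = (\<Union>U \<in> {U \<in> Pow S. card U \<le> DIM('a)}. affine hull U)"
  have "negligible N" unfolding N_def
    by (intro negligible_Union finite_imageI)
       (use fin in \<open>auto intro!: negligible_affine_hull_small dest: finite_subset\<close>)
  \<comment> \<open>Off \<open>N\<close> the tight points cannot be fewer than \<open>d + 1\<close>; closedness of the union recovers the rest.\<close>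
  have generic: "x \<in> \<Union>(delaunay S)" if x: "x \<in> ?I" "x \<notin> N" for x
  proof -
    obtain c r where c: "\<And>q. q \<in> S \<Longrightarrow> r \<le> norm (c - q)"
      "x \<in> convex hull {p \<in> S. norm (c - p) = r}"
      using supporting_paraboloid[OF fin x(1)] by blast
    define T where "T = {p \<in> S. norm (c - p) = r}"
    have "T \<subseteq> S" by (auto simp: T_def)
    have "card T \<le> DIM('a) + 1"
      by (rule generic_card_sphere[OF S \<open>T \<subseteq> S\<close>, of c r]) (simp add: T_def)
    moreover have "\<not> card T \<le> DIM('a)"
    proof
      assume "card T \<le> DIM('a)"
      moreover have "x \<in> affine hull T"
        using c(2) convex_hull_subset_affine_hull unfolding T_def by blast
      ultimately show False using x(2) \<open>T \<subseteq> S\<close> by (auto simp: N_def)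
    qed
    ultimately have "card T = DIM('a) + 1" by simp
    then have "convex hull T \<in> delaunay S"
      using \<open>T \<subseteq> S\<close> c(1) by (intro delaunayI[of _ _ c r]) (auto simp: T_def)
    then show ?thesis using c(2) by (auto simp: T_def)
  qed
  have "closed (\<Union>(delaunay S))"
  proof (rule closed_Union[OF finite_delaunay[OF S]], rule ballI)
    fix D assume "D \<in> delaunay S"
    then obtain T where "T \<subseteq> S" "D = convex hull T" by (auto simp: delaunay_def)
    then show "closed D"
      using fin by (auto intro!: compact_imp_closed finite_imp_compact_convex_hull dest: finite_subset)
  qed
  \<comment> \<open>The uncovered part of the interior is open and null, hence empty; the hull lies
    in the closure of its interior.\<close>
  then have "open (?I - \<Union>(delaunay S))" by (intro open_Diff open_interior)
  moreover have "negligible (?I - \<Union>(delaunay S))"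
    using \<open>negligible N\<close> by (rule negligible_subset) (use generic in blast)
  ultimately have "?I \<subseteq> \<Union>(delaunay S)"
    using open_not_negligible by blast
  then have "closure ?I \<subseteq> \<Union>(delaunay S)"
    using \<open>closed (\<Union>(delaunay S))\<close> by (rule closure_minimal)
  moreover have "closure ?I = closure (convex hull S)"
    by (rule convex_closure_interior) (use interior_convex_hull_generic[OF S] in auto)
  ultimately show "convex hull S \<subseteq> \<Union>(delaunay S)"
    using closure_subset by blast
qed

text \<open>The affine function that agrees with \<open>\<lambda>x. (norm x)\<^sup>2\<close> exactly on the sphere with
  centre \<open>c\<close> and radius \<open>r\<close>.\<close>

definition power_plane :: "'a::euclidean_space \<Rightarrow> real \<Rightarrow> 'a \<Rightarrow> real" where
  "power_plane c r x = (2 *\<^sub>R c) \<bullet> x + (r\<^sup>2 - (norm c)\<^sup>2)"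

text \<open>The right-hand side is the power of \<open>x\<close> with respect to the sphere. An
  empty sphere thus means that all lifted points of \<open>S\<close> lie on or above the
  plane.\<close>

lemma norm_power_plane: "(norm x)\<^sup>2 - power_plane c r x = (norm (c - x))\<^sup>2 - r\<^sup>2"
  by (simp add: power_plane_def power2_norm_eq_inner inner_diff_left inner_diff_right inner_commute)

lemma power_plane_sum:
  "sum u V = 1 \<Longrightarrow> power_plane c r (\<Sum>w\<in>V. u w *\<^sub>R w) = (\<Sum>w\<in>V. u w * power_plane c r w)"
  unfolding power_plane_def by (rule affine_sum)

lemma power_plane_bary:
  "affine_basis V \<Longrightarrow> power_plane c r x = (\<Sum>w\<in>V. bary V w x * power_plane c r w)"
  using power_plane_sum[of "\<lambda>w. bary V w x" V c r] bary_combination[of V x] by simp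

text \<open>The difference \<open>h\<close> of the two power planes is nonnegative on
  \<open>T\<close>, positive on \<open>T - T'\<close> and nonpositive on \<open>T'\<close>.
  Interpolating from either simplex gives \<open>h x = 0\<close>, so no vertex in
  \<open>T - T'\<close> can carry weight.\<close>

lemma bary_eq_0_if_Delaunay:
  assumes T: "affine_basis T" "T \<subseteq> S" "\<And>p. p \<in> T \<Longrightarrow> norm (c - p) = r" "\<And>q. q \<in> S - T \<Longrightarrow> r < norm (c - q)"
    and T': "affine_basis T'" "T' \<subseteq> S" "\<And>p. p \<in> T' \<Longrightarrow> norm (c' - p) = r'" "\<And>q. q \<in> S - T' \<Longrightarrow> r' < norm (c' - q)"
    and x: "x \<in> convex hull T" "x \<in> convex hull T'" and v: "v \<in> T - T'" 
  shows "bary T v x = 0"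
proof -
  have nonneg: "0 \<le> r" "0 \<le> r'"
    using T(1,3) T'(1,3) by (metis affine_basis_def card.empty add_is_0 all_not_in_conv norm_ge_zero one_neq_zero)+
  define h where "h y = power_plane c r y - power_plane c' r' y" for y
  have h1: "h p \<ge> 0 \<and> (p \<notin> T' \<longrightarrow> h p > 0)" if "p \<in> T" for p
  proof -
    have "h p = (norm (c' - p))\<^sup>2 - r'\<^sup>2"
      using norm_power_plane[of p c r] norm_power_plane[of p c' r'] T(3)[OF that] by (simp add: h_def)
    moreover have "p \<notin> T' \<Longrightarrow> r'\<^sup>2 < (norm (c' - p))\<^sup>2"
      using T'(4)[of p] T(2) that nonneg by (intro power_strict_mono) auto
    ultimately show ?thesis using T'(3)[of p] by (cases "p \<in> T'") auto
  qed
  have h2: "h p \<le> 0" if "p \<in> T'" for p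
  proof -
    have "h p = r\<^sup>2 - (norm (c - p))\<^sup>2"
      using norm_power_plane[of p c r] norm_power_plane[of p c' r'] T'(3)[OF that] by (simp add: h_def)
    moreover have "p \<notin> T \<Longrightarrow> r\<^sup>2 < (norm (c - p))\<^sup>2"
      using T(4)[of p] T'(2) that nonneg by (intro power_strict_mono) auto
    ultimately show ?thesis using T(3)[of p] by (cases "p \<in> T") auto
  qed
  have eq: "h x = (\<Sum>p\<in>U. bary U p x * h p)" if "affine_basis U" for U
    using power_plane_bary[OF that, of c r x] power_plane_bary[OF that, of c' r' x]
    by (simp add: h_def right_diff_distrib sum_subtractf)
  have pos: "\<And>p. p \<in> T \<Longrightarrow> bary T p x \<ge> 0" "\<And>p. p \<in> T' \<Longrightarrow> bary T' p x \<ge> 0"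
    using x convex_hull_bary[OF T(1)] convex_hull_bary[OF T'(1)] by auto
  have "h x \<le> 0" unfolding eq[OF T'(1)]
    using h2 pos by (intro sum_nonpos mult_nonneg_nonpos) auto
  moreover have ge0: "\<And>p. p \<in> T \<Longrightarrow> bary T p x * h p \<ge> 0"
    using h1 pos by (intro mult_nonneg_nonneg) auto
  then have "h x \<ge> 0" unfolding eq[OF T(1)] by (rule sum_nonneg)
  ultimately have "(\<Sum>p\<in>T. bary T p x * h p) = 0" using eq[OF T(1)] by simp
  then have "bary T v x * h v = 0"
    using sum_nonneg_eq_0_iff[OF affine_basis_finite[OF T(1)], of "\<lambda>p. bary T p x * h p"] ge0 v by auto
  then show ?thesis using h1[of v] v by auto
qed

lemma convex_hull_subset_bary:
  assumes V: "affine_basis V" and "U \<subseteq> V" "x \<in> convex hull V" "\<And>v. v \<in> V - U \<Longrightarrow> bary V v x = 0"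
  shows "x \<in> convex hull U"
proof -
  note fin = affine_basis_finite[OF V]
  have "sum (\<lambda>v. bary V v x) U = 1" "(\<Sum>v\<in>U. bary V v x *\<^sub>R v) = x"
    using bary_combination[OF V, of x] assms(2,4) fin
    by (simp_all add: sum.mono_neutral_left[of V U])
  moreover have "\<forall>v\<in>U. bary V v x \<ge> 0"
    using assms(2,3) convex_hull_bary[OF V] by auto
  ultimately have "\<exists>u. (\<forall>v\<in>U. 0 \<le> u v) \<and> sum u U = 1 \<and> (\<Sum>v\<in>U. u v *\<^sub>R v) = x"
    by (intro exI[of _ "\<lambda>v. bary V v x"]) simp
  then show ?thesis
    unfolding convex_hull_finite[OF finite_subset[OF assms(2) fin]] by simp
qed

lemma vertices_of_convex_hull: "affine_basis V \<Longrightarrow> vertices_of (convex hull V) = V"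
  by (simp add: vertices_of_def affine_basis_def extreme_point_of_convex_hull_affine_independent)

lemma triangulation_of_delaunay:
  fixes S :: "'a::euclidean_space set"
  assumes S: "generic_points S"
  shows "triangulation_of S (delaunay S)"
proof -
  have dsimplex: "int DIM('a) simplex D" if D: "D \<in> delaunay S" for D
  proof -
    obtain T where "D = convex hull T" "affine_basis T" using delaunayE[OF S D] by metis
    then show ?thesis unfolding simplex_def affine_basis_def by (intro exI[of _ T]) simp
  qed
  have "(D \<inter> D') face_of D" if D: "D \<in> delaunay S" and D': "D' \<in> delaunay S" for D D'
  proof -
    obtain T c r where T: "D = convex hull T" "T \<subseteq> S" "affine_basis T"
      "\<And>p. p \<in> T \<Longrightarrow> norm (c - p) = r" "\<And>q. q \<in> S - T \<Longrightarrow> r < norm (c - q)"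
      using delaunayE[OF S D] by metis
    obtain T' c' r' where T': "D' = convex hull T'" "T' \<subseteq> S" "affine_basis T'"
      "\<And>p. p \<in> T' \<Longrightarrow> norm (c' - p) = r'" "\<And>q. q \<in> S - T' \<Longrightarrow> r' < norm (c' - q)"
      using delaunayE[OF S D'] by metis
    \<comment> \<open>Once the intersection is the hull of the common vertices, it is a face of a
      simplex.\<close>
    have "D \<inter> D' = convex hull (T \<inter> T')"
    proof
      show "D \<inter> D' \<subseteq> convex hull (T \<inter> T')"
      proof
        fix x assume "x \<in> D \<inter> D'"
        then have x: "x \<in> convex hull T" "x \<in> convex hull T'" using T(1) T'(1) by auto
        have "bary T v x = 0" if "v \<in> T - (T \<inter> T')" for v
          using bary_eq_0_if_Delaunay[OF T(3,2,4,5) T'(3,2,4,5) x] that by simp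
        then show "x \<in> convex hull (T \<inter> T')"
          by (rule convex_hull_subset_bary[OF T(3) Int_lower1 x(1)])
      qed
      show "convex hull (T \<inter> T') \<subseteq> D \<inter> D'"
        unfolding T(1) T'(1) by (simp add: hull_mono)
    qed
    then show ?thesis
      unfolding T(1) using T(3) face_of_convex_hull_affine_independent[of T]
      by (auto simp: affine_basis_def)
  qed
  then have "triangulation (delaunay S)"
    unfolding triangulation_def using finite_delaunay[OF S] dsimplex by blast
  moreover have "(\<Union>D\<in>delaunay S. vertices_of D) = S"
  proof
    show "(\<Union>D\<in>delaunay S. vertices_of D) \<subseteq> S"
    proof clarify
      fix D p assume D: "D \<in> delaunay S" "p \<in> vertices_of D"
      obtain T where "D = convex hull T" "affine_basis T" "T \<subseteq> S" using delaunayE[OF S D(1)] by metis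
      then show "p \<in> S" using D(2) vertices_of_convex_hull by auto
    qed
    show "S \<subseteq> (\<Union>D\<in>delaunay S. vertices_of D)"
    proof
      fix p assume "p \<in> S"
      then have "p \<in> \<Union>(delaunay S)" unfolding delaunay_cover[OF S] by (rule hull_inc)
      then obtain D where D: "D \<in> delaunay S" "p \<in> D" by blast
      obtain T c r where T: "D = convex hull T" "T \<subseteq> S" "affine_basis T"
        "\<And>p. p \<in> T \<Longrightarrow> norm (c - p) = r" "\<And>q. q \<in> S - T \<Longrightarrow> r < norm (c - q)"
        using delaunayE[OF S D(1)] by metis
      \<comment> \<open>A point of \<open>S\<close> in \<open>D\<close> lies in the circumscribed
        ball, which contains no point of \<open>S\<close> outside \<open>T\<close>; so it is a
        vertex of \<open>D\<close>.\<close>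
      have "T \<subseteq> cball c r" using T(4) by (auto simp: dist_norm)
      then have "D \<subseteq> cball c r" unfolding T(1) by (simp add: hull_minimal)
      then have "norm (c - p) \<le> r" using D(2) by (auto simp: dist_norm)
      then have "p \<in> T" using T(5)[of p] \<open>p \<in> S\<close> by force
      then show "p \<in> (\<Union>D\<in>delaunay S. vertices_of D)"
        using D(1) vertices_of_convex_hull[OF T(3)] T(1) by auto
    qed
  qed
  ultimately show ?thesis
    unfolding triangulation_of_def using dsimplex delaunay_cover[OF S] by blast
qed

section \<open>Comparing triangulations\<close>

lemma triangulation_of_member:
  fixes S :: "'a::euclidean_space set"
  assumes "triangulation_of S t" "D \<in> t"
  shows "affine_basis (vertices_of D)" "D = convex hull (vertices_of D)" "vertices_of D \<subseteq> S"
proof -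
  have "int DIM('a) simplex D" using assms by (simp add: triangulation_of_def)
  then obtain V where V: "\<not> affine_dependent V" "int (card V) = int DIM('a) + 1" "D = convex hull V"
    unfolding simplex_def by blast
  then have "affine_basis V" by (simp add: affine_basis_def)
  with V(3) show "affine_basis (vertices_of D)" "D = convex hull (vertices_of D)"
    using vertices_of_convex_hull by metis+
  show "vertices_of D \<subseteq> S"
    using assms unfolding triangulation_of_def by blast
qed

lemma triangulation_of_compact: "triangulation_of S t \<Longrightarrow> D \<in> t \<Longrightarrow> compact D"
  using triangulation_of_member[of S t D] compact_convex_hull_basis by metis

text \<open>The intersection is a face of both simplices and proper in at least one, hence contained
  in the null frontier of that one.\<close>

lemma triangulation_of_negligible_Int:
  assumes t: "triangulation_of S t" and "D \<in> t" "D' \<in> t" "D \<noteq> D'"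
  shows "negligible (D \<inter> D')"
proof -
  have face: "(D \<inter> D') face_of D" "(D \<inter> D') face_of D'"
    using assms unfolding triangulation_of_def triangulation_def by (metis Int_commute)+
  have conv: "convex D" "convex D'"
    using triangulation_of_member(2)[OF t] assms(2,3) convex_convex_hull by metis+
  have "negligible (E \<inter> E')" if "(E \<inter> E') face_of E" "E \<inter> E' \<noteq> E" "convex E" for E E' :: "'a set"
  proof (rule negligible_subset[OF negligible_convex_frontier[OF that(3)]])
    show "E \<inter> E' \<subseteq> frontier E"
      using face_of_disjoint_interior[OF that(1,2)] closure_subset unfolding frontier_def by blast
  qed
  from this[of D D'] this[of D' D] show ?thesis
    using face conv assms(4) by (auto simp: Int_commute)
qed

text \<open>\<open>K\<close> is arbitrary so that it can be the whole hull or a simplex of another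
  triangulation; the latter gives the common refinement.\<close>

lemma integral_triangulation:
  fixes g :: "'a::euclidean_space \<Rightarrow> real"
  assumes t: "triangulation_of S t" and K: "compact K" "K \<subseteq> convex hull S"
    and g: "continuous_on UNIV g"
  shows "(LINT x:K|lborel. g x) = (\<Sum>D\<in>t. LINT x:K \<inter> D|lborel. g x)"
proof -
  have "K = (\<Union>D\<in>t. K \<inter> D)"
    using t K(2) by (auto simp: triangulation_of_def)
  then have "(LINT x:K|lborel. g x) = (LINT x:(\<Union>D\<in>t. K \<inter> D)|lborel. g x)" by simp
  also have "\<dots> = (\<Sum>D\<in>t. LINT x:K \<inter> D|lborel. g x)"
  proof (rule set_integral_finite_UN_AE)
    show "finite t" using t by (simp add: triangulation_of_def triangulation_def)
    show "K \<inter> D \<in> sets lborel" if "D \<in> t" for D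
      using that K(1) triangulation_of_compact[OF t] by (auto intro: borel_compact)
    show "set_integrable lborel (K \<inter> D) g" if "D \<in> t" for D
      unfolding set_integrable_def
    proof (rule borel_integrable_compact)
      show "compact (K \<inter> D)" using K(1) triangulation_of_compact[OF t that] by (rule compact_Int)
    qed (rule continuous_on_subset[OF g], simp)
    show "AE x in lborel. x \<in> K \<inter> D \<and> x \<in> K \<inter> D' \<longrightarrow> D = D'" if D: "D \<in> t" "D' \<in> t" for D D'
    proof (cases "D = D'")
      case False
      have "D \<inter> D' \<in> sets lborel"
        using D triangulation_of_compact[OF t] by (auto intro: borel_compact)
      then have "D \<inter> D' \<in> null_sets lborel"
        using triangulation_of_negligible_Int[OF t D False]
        by (simp add: negligible_iff_null_sets null_sets_completion_iff)
      then show ?thesis by (rule AE_I') auto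
    qed simp
  qed
  finally show ?thesis .
qed

definition interp_integral :: "'a::euclidean_space set set \<Rightarrow> real" where
  "interp_integral t = (\<Sum>D\<in>t. LINT x:D|lborel. interp (vertices_of D) x)"

lemma C2_interp_integral:
  obtains A B :: real where "B > 0"
    "\<And>(S :: 'a::euclidean_space set) t. finite S \<Longrightarrow> triangulation_of S t \<Longrightarrow>
      C2 t = A * (LINT x:convex hull S|lborel. (norm x)\<^sup>2) - B * interp_integral t"
proof -
  obtain A B :: real where "B > 0" and AB:
    "\<And>V :: 'a::euclidean_space set. affine_basis V \<Longrightarrow>
      (norm ((1 / real (DIM('a) + 1)) *\<^sub>R \<Sum>V))\<^sup>2 * measure lborel (convex hull V) =
      A * (LINT x:convex hull V|lborel. (norm x)\<^sup>2) - B * (LINT x:convex hull V|lborel. interp V x)"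
    using barycenter_term[where 'a = 'a] by metis
  show thesis
  proof (rule that[OF \<open>B > 0\<close>])
    fix S :: "'a set" and t assume S: "finite S" and t: "triangulation_of S t"
    have "(LINT x:convex hull S|lborel. (norm x)\<^sup>2) = (\<Sum>D\<in>t. LINT x:convex hull S \<inter> D|lborel. (norm x)\<^sup>2)"
      by (intro integral_triangulation[OF t] finite_imp_compact_convex_hull S order_refl continuous_intros)
    also have "\<dots> = (\<Sum>D\<in>t. LINT x:D|lborel. (norm x)\<^sup>2)"
    proof (rule sum.cong[OF refl])
      fix D assume "D \<in> t"
      then have "convex hull S \<inter> D = D" using t by (auto simp: triangulation_of_def)
      then show "(LINT x:convex hull S \<inter> D|lborel. (norm x)\<^sup>2) = (LINT x:D|lborel. (norm x)\<^sup>2)" by simp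
    qed
    finally have "A * (LINT x:convex hull S|lborel. (norm x)\<^sup>2) - B * interp_integral t =
      (\<Sum>D\<in>t. A * (LINT x:D|lborel. (norm x)\<^sup>2) - B * (LINT x:D|lborel. interp (vertices_of D) x))"
      by (simp add: interp_integral_def sum_subtractf sum_distrib_left)
    also have "\<dots> = C2 t"
      unfolding C2_def
    proof (rule sum.cong[OF refl])
      fix D assume D: "D \<in> t"
      note V = triangulation_of_member[OF t D]
      have m: "measure lebesgue D = measure lborel D"
        using measure_hull_lborel[OF V(1)] V(2) by simp
      show "A * (LINT x:D|lborel. (norm x)\<^sup>2) - B * (LINT x:D|lborel. interp (vertices_of D) x) =
        (norm (barycenter D))\<^sup>2 * measure lebesgue D"
        using AB[OF V(1)] unfolding barycenter_def V(2)[symmetric] m by simp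
    qed
    finally show "C2 t = A * (LINT x:convex hull S|lborel. (norm x)\<^sup>2) - B * interp_integral t" by simp
  qed
qed

text \<open>The interpolant of a Delaunay simplex is its power plane, so the difference at
  \<open>x\<close> is the average, with the coordinates of \<open>x\<close> as weights, of the
  powers of the vertices of \<open>V\<close>, all nonnegative. If it vanishes with no weight zero,
  every vertex lies on the sphere, and counting gives equal vertex sets.\<close>

lemma interp_delaunay_le:
  fixes S :: "'a::euclidean_space set"
  assumes S: "generic_points S" and D: "D \<in> delaunay S"
    and V: "affine_basis V" "V \<subseteq> S" "x \<in> convex hull V"
  shows "interp (vertices_of D) x \<le> interp V x"
    and "interp V x = interp (vertices_of D) x \<Longrightarrow> (\<And>v. v \<in> V \<Longrightarrow> bary V v x \<noteq> 0) \<Longrightarrow> convex hull V = D"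
proof -
  obtain T c r where T: "D = convex hull T" "T \<subseteq> S" "affine_basis T"
    "\<And>p. p \<in> T \<Longrightarrow> norm (c - p) = r" "\<And>q. q \<in> S - T \<Longrightarrow> r < norm (c - q)"
    using delaunayE[OF S D] by metis
  have [simp]: "vertices_of D = T" unfolding T(1) by (rule vertices_of_convex_hull[OF T(3)])
  have "0 \<le> r"
    using T(3,4) by (metis affine_basis_def card.empty add_is_0 all_not_in_conv norm_ge_zero one_neq_zero)
  have "interp T x = (\<Sum>p\<in>T. bary T p x * power_plane c r p)"
    unfolding interp_def
  proof (intro sum.cong refl)
    fix p assume "p \<in> T"
    then show "bary T p x * (norm p)\<^sup>2 = bary T p x * power_plane c r p"
      using norm_power_plane[of p c r] T(4) by simp
  qed
  then have interp_T: "interp T x = power_plane c r x"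
    using power_plane_bary[OF T(3), of c r x] by simp
  have diff: "interp V x - interp T x = (\<Sum>v\<in>V. bary V v x * ((norm (c - v))\<^sup>2 - r\<^sup>2))"
  proof -
    have "interp V x - power_plane c r x = (\<Sum>v\<in>V. bary V v x * ((norm v)\<^sup>2 - power_plane c r v))"
      unfolding power_plane_bary[OF V(1), of c r x] interp_def
      by (simp add: right_diff_distrib sum_subtractf)
    then show ?thesis by (simp add: interp_T norm_power_plane)
  qed
  have strict: "r\<^sup>2 < (norm (c - v))\<^sup>2" if "v \<in> V" "v \<notin> T" for v
    using T(5)[of v] that V(2) \<open>0 \<le> r\<close> by (intro power_strict_mono) auto
  have nonneg: "bary V v x * ((norm (c - v))\<^sup>2 - r\<^sup>2) \<ge> 0" if "v \<in> V" for v
  proof (rule mult_nonneg_nonneg)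
    show "bary V v x \<ge> 0" using V convex_hull_bary that by blast
    show "(norm (c - v))\<^sup>2 - r\<^sup>2 \<ge> 0"
      using strict[OF that] T(4)[of v] by (cases "v \<in> T") auto
  qed
  then have "interp V x - interp T x \<ge> 0" unfolding diff by (rule sum_nonneg)
  then show "interp (vertices_of D) x \<le> interp V x" by simp
  assume eq: "interp V x = interp (vertices_of D) x" and nz: "\<And>v. v \<in> V \<Longrightarrow> bary V v x \<noteq> 0"
  have "V \<subseteq> T"
  proof
    fix v assume v: "v \<in> V"
    have "bary V v x * ((norm (c - v))\<^sup>2 - r\<^sup>2) = 0"
      using sum_nonneg_eq_0_iff[OF affine_basis_finite[OF V(1)] nonneg] eq diff v by simp
    then show "v \<in> T" using nz[OF v] strict[OF v] by auto
  qed
  then have "V = T"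
    using V(1) T(3) affine_basis_finite[OF T(3)] by (simp add: affine_basis_def card_subset_eq)
  then show "convex hull V = D" using T(1) by simp
qed

text \<open>Over the common refinement the difference of the two integrals is a sum of integrals of
  the nonnegative functions \<open>h D D'\<close>. Equality makes each of them zero, which forces
  overlapping simplices to coincide.\<close>

lemma delaunay_minimizes:
  fixes S :: "'a::euclidean_space set"
  assumes S: "generic_points S" and t: "triangulation_of S t"
  shows "interp_integral (delaunay S) \<le> interp_integral t"
    and "interp_integral t \<le> interp_integral (delaunay S) \<Longrightarrow> t = delaunay S"
proof -
  let ?d = "delaunay S"
  note d = triangulation_of_delaunay[OF S]
  have fin: "finite t" "finite ?d"
    using t finite_delaunay[OF S] by (auto simp: triangulation_of_def triangulation_def)
  have cont: "continuous_on A (interp (vertices_of D))" if "D \<in> t \<or> D \<in> ?d" for A D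
    using that triangulation_of_member(1)[OF t] triangulation_of_member(1)[OF d]
    by (auto intro: continuous_on_interp)
  define h where "h D D' x = interp (vertices_of D) x - interp (vertices_of D') x" for D D' :: "'a set" and x
  have split: "interp_integral t' = (\<Sum>D\<in>t'. \<Sum>D'\<in>t''. LINT x:D \<inter> D'|lborel. interp (vertices_of D) x)"
    if "triangulation_of S t'" "triangulation_of S t''" "t' \<in> {t, ?d}" for t' t''
    unfolding interp_integral_def
  proof (intro sum.cong refl integral_triangulation[OF that(2)])
    fix D assume "D \<in> t'"
    then show "compact D" "D \<subseteq> convex hull S" "continuous_on UNIV (interp (vertices_of D))"
      using that triangulation_of_compact[OF that(1)] cont by (auto simp: triangulation_of_def)
  qed
  have int: "set_integrable lborel (D \<inter> D') (interp (vertices_of E))"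
    if "D \<in> t" "D' \<in> ?d" "E \<in> {D, D'}" for D D' E
    unfolding set_integrable_def
    by (rule borel_integrable_compact)
       (use that cont triangulation_of_compact[OF t] triangulation_of_compact[OF d] in auto)
  have "interp_integral ?d = (\<Sum>D\<in>t. \<Sum>D'\<in>?d. LINT x:D \<inter> D'|lborel. interp (vertices_of D') x)"
    unfolding split[OF d t insertI2[OF singletonI]] by (subst sum.swap) (simp add: Int_commute)
  then have diff: "interp_integral t - interp_integral ?d = (\<Sum>D\<in>t. \<Sum>D'\<in>?d. LINT x:D \<inter> D'|lborel. h D D' x)"
    unfolding split[OF t d insertI1] h_def using int
    by (simp add: set_integral_diff flip: sum_subtractf)
  have h_nonneg: "h D D' x \<ge> 0" if "D \<in> t" "D' \<in> ?d" "x \<in> D \<inter> D'" for D D' x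
    using interp_delaunay_le(1)[OF S that(2) triangulation_of_member(1,3)[OF t that(1)], of x]
      triangulation_of_member(2)[OF t that(1)] that(3) by (auto simp: h_def)
  have nonneg: "(LINT x:D \<inter> D'|lborel. h D D' x) \<ge> 0" if "D \<in> t" "D' \<in> ?d" for D D'
    unfolding set_lebesgue_integral_def
    by (rule integral_nonneg_AE) (use h_nonneg[OF that] in \<open>auto simp: indicator_def\<close>)
  then have nonneg': "(\<Sum>D'\<in>?d. LINT x:D \<inter> D'|lborel. h D D' x) \<ge> 0" if "D \<in> t" for D
    using that by (intro sum_nonneg)
  then have "interp_integral t - interp_integral ?d \<ge> 0"
    unfolding diff by (rule sum_nonneg)
  then show "interp_integral ?d \<le> interp_integral t" by simp
  assume le: "interp_integral t \<le> interp_integral ?d"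
  with \<open>interp_integral ?d \<le> interp_integral t\<close>
  have "(\<Sum>D\<in>t. \<Sum>D'\<in>?d. LINT x:D \<inter> D'|lborel. h D D' x) = 0" using diff by simp
  then have "(\<Sum>D'\<in>?d. LINT x:D \<inter> D'|lborel. h D D' x) = 0" if "D \<in> t" for D
    using sum_nonneg_eq_0_iff[OF fin(1) nonneg'] that by simp
  then have zero: "(LINT x:D \<inter> D'|lborel. h D D' x) = 0" if "D \<in> t" "D' \<in> ?d" for D D'
    using sum_nonneg_eq_0_iff[OF fin(2), of "\<lambda>D'. LINT x:D \<inter> D'|lborel. h D D' x"] nonneg that
    by simp
  \<comment> \<open>Outside null sets, points of \<open>D \<inter> D'\<close> have equal
    interpolants and no zero coordinate in \<open>D\<close>; a single such point gives
    \<open>D = D'\<close> by the equality case.\<close>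
  have key: "D = D'" if D: "D \<in> t" "D' \<in> ?d" and nn: "\<not> negligible (D \<inter> D')" for D D'
  proof (rule ccontr)
    assume "D \<noteq> D'"
    let ?V = "vertices_of D"
    note V = triangulation_of_member[OF t D(1)]
    have "negligible {x \<in> D \<inter> D'. h D D' x \<noteq> 0}"
    proof (rule negligible_zero_of_integral_nonpos)
      show "compact (D \<inter> D')"
        using D triangulation_of_compact[OF t] triangulation_of_compact[OF d] by auto
      show "continuous_on UNIV (h D D')"
        unfolding h_def using D cont by (intro continuous_on_diff) auto
    qed (use h_nonneg[OF D] zero[OF D] in auto)
    moreover have "negligible (\<Union>v\<in>?V. {x. bary ?V v x = 0})"
      using V(1) affine_basis_finite[OF V(1)] negligible_bary_zero by (intro negligible_Union) auto
    ultimately have "negligible ({x \<in> D \<inter> D'. h D D' x \<noteq> 0} \<union> (\<Union>v\<in>?V. {x. bary ?V v x = 0}))"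
      by (rule negligible_Un)
    moreover have "D \<inter> D' \<subseteq> {x \<in> D \<inter> D'. h D D' x \<noteq> 0} \<union> (\<Union>v\<in>?V. {x. bary ?V v x = 0})"
    proof
      fix x assume x: "x \<in> D \<inter> D'"
      then have "x \<in> convex hull ?V" using V(2) by auto
      then show "x \<in> {x \<in> D \<inter> D'. h D D' x \<noteq> 0} \<union> (\<Union>v\<in>?V. {x. bary ?V v x = 0})"
        using interp_delaunay_le(2)[OF S D(2) V(1,3), of x] V(2) \<open>D \<noteq> D'\<close> x
        by (auto simp: h_def)
    qed
    ultimately show False using nn negligible_subset by blast
  qed
  \<comment> \<open>A member of \<open>t1\<close> is not null and is covered by the finitely many
    members of \<open>t2\<close>, so it meets one of them in a set that is not null. Stated for a
    general pair because it is used in both directions.\<close>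
  have subset: "t1 \<subseteq> t2" if t12: "triangulation_of S t1" "triangulation_of S t2"
    and eq: "\<And>D D'. D \<in> t1 \<Longrightarrow> D' \<in> t2 \<Longrightarrow> \<not> negligible (D \<inter> D') \<Longrightarrow> D = D'" for t1 t2
  proof
    fix D assume D: "D \<in> t1"
    have "finite t2" "D \<subseteq> \<Union>t2"
      using t12 D by (auto simp: triangulation_of_def triangulation_def)
    have "\<not> negligible D"
      using not_negligible_hull triangulation_of_member(1,2)[OF t12(1) D] by metis
    moreover have "D = (\<Union>D'\<in>t2. D \<inter> D')" using \<open>D \<subseteq> \<Union>t2\<close> by blast
    ultimately have "\<not> negligible (\<Union>D'\<in>t2. D \<inter> D')" by simp
    then obtain D' where "D' \<in> t2" "\<not> negligible (D \<inter> D')"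
      using \<open>finite t2\<close> by (metis (no_types, lifting) finite_imageI imageE negligible_Union)
    then show "D \<in> t2" using eq D by blast
  qed
  show "t = ?d"
  proof
    show "t \<subseteq> ?d" by (rule subset[OF t d key])
    show "?d \<subseteq> t" by (rule subset[OF d t]) (metis key Int_commute)
  qed
qed

theorem theorem1:
  fixes S :: "'a::euclidean_space set" and t :: "'a set set"
  assumes "generic_points S"
    and "triangulation_of S t"
  shows "(\<forall>t'. triangulation_of S t' \<longrightarrow> C2 t' \<le> C2 t) \<longleftrightarrow> t = delaunay S"
proof -
  obtain A B :: real where "B > 0" and C2:
    "\<And>t. triangulation_of S t \<Longrightarrow>
      C2 t = A * (LINT x:convex hull S|lborel. (norm x)\<^sup>2) - B * interp_integral t"
    using C2_interp_integral[where 'a = 'a] assms(1) unfolding generic_points_def by metis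
  have le: "C2 t' \<le> C2 t'' \<longleftrightarrow> interp_integral t'' \<le> interp_integral t'"
    if "triangulation_of S t'" "triangulation_of S t''" for t' t''
    using \<open>B > 0\<close> by (simp add: C2 that)
  show ?thesis
  proof
    assume "\<forall>t'. triangulation_of S t' \<longrightarrow> C2 t' \<le> C2 t"
    \<comment> \<open>The Delaunay triangulation is itself an admissible competitor.\<close>
    then have "interp_integral t \<le> interp_integral (delaunay S)"
      using le[OF triangulation_of_delaunay[OF assms(1)] assms(2)]
        triangulation_of_delaunay[OF assms(1)] by simp
    then show "t = delaunay S" by (rule delaunay_minimizes(2)[OF assms])
  next
    assume "t = delaunay S"
    then show "\<forall>t'. triangulation_of S t' \<longrightarrow> C2 t' \<le> C2 t"
      using le assms delaunay_minimizes(1)[OF assms(1)] by blast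
  qed
qed

end
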